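(* Let $\mathbb{F}$ be any field. The two subgroups $$S_{(3)}=\left\{\begin{pmatrix}1&x_1&x_2\\0&1&x_1\\0&0&1\end{pmatrix}:x_1,x_2\in\mathbb{F}\right\},\qquad S_{(2,1)}=\left\{\begin{pmatrix}1&x_1&x_2\\0&1&0\\0&0&1\end{pmatrix}:x_1,x_2\in\mathbb{F}\right\}$$ form a complete set of representatives of the conjugacy classes in $\mathrm{AGL}_2(\mathbb{F})$ of the regular subgroups $U$ of $\mathrm{AGL}_2(\mathbb{F})$ for which $\delta_U$ is linear (i.e. each such $U$ is conjugate to exactly one of them). The corresponding algebras are $\mathbb{F}I_3+S_{(3)}\cong\mathbb{F}[t_1]/\langle t_1^3\rangle$ and $\mathbb{F}I_3+S_{(2,1)}\cong\mathbb{F}[t_1,t_2]/\langle t_1,t_2\rangle^2$. Moreover $S_{(3)}$ is indecomposable.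
   Context: $\mathrm{AGL}_n(\mathbb{F})$ is the subgroup of $\mathrm{GL}_{n+1}(\mathbb{F})$ consisting of the matrices with first column $(1,0,\dots,0)^{\mathrm T}$; $\pi:\mathrm{AGL}_n(\mathbb{F})\to\mathrm{GL}_n(\mathbb{F})$ sends $\begin{pmatrix}1&v\\0&A\end{pmatrix}$ to $A$. A subgroup $R\le\mathrm{AGL}_n(\mathbb{F})$ is regular if for every $v\in\mathbb{F}^n$ there is exactly one element of $R$ with first row $(1,v)$; this element is written $\begin{pmatrix}1&v\\0&I_n+\delta_R(v)\end{pmatrix}$, defining a map $\delta_R:\mathbb{F}^n\to\mathrm{Mat}_n(\mathbb{F})$. "$\delta_R$ linear" means $\mathbb{F}$-linear. A subgroup $H\le\mathrm{AGL}_n(\mathbb{F})$ is indecomposable if $\mathbb{F}^n$ is not a direct sum of non-trivial $\pi(H)$-invariant subspaces (acting on row vectors from the right). $\mathbb{F}I_{n+1}+U=\{\alpha I_{n+1}+\beta u:\alpha,\beta\in\mathbb{F},\ u\in U\}$, an algebra of matrices when $\delta_U$ is linear. *)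

theory Defs
  imports
    "Jordan_Normal_Form.VS_Connect"
    "HOL-Algebra.QuotRing"
    "HOL-Algebra.Ideal_Product"
    "HOL-Library.Poly_Mapping"
    "HOL-Library.Numeral_Type"
begin

section \<open>Affine groups and regular subgroups\<close>

definition GL :: "nat \<Rightarrow> 'a::field mat monoid" where
  "GL n = units_of (ring_mat TYPE('a) n ())"

definition AGL :: "nat \<Rightarrow> 'a::field mat monoid" where
  "AGL n = (GL (Suc n))\<lparr>carrier := {g \<in> carrier (GL (Suc n)). col g 0 = unit_vec (Suc n) 0}\<rparr>"

text \<open>The map \<open>\<pi>\<close>: remove the first row and the first column.\<close>

definition linear_part :: "'a mat \<Rightarrow> 'a mat" where
  "linear_part g = mat_delete g 0 0"

definition regular_subgroup :: "nat \<Rightarrow> 'a::field mat set \<Rightarrow> bool" where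
  "regular_subgroup n R \<longleftrightarrow>
     subgroup R (AGL n) \<and> (\<forall>v\<in>carrier_vec n. \<exists>!g. g \<in> R \<and> row g 0 = vCons 1 v)"

text \<open>Only meaningful for regular \<open>R\<close> and \<open>v\<close> of dimension \<open>n\<close>.\<close>

definition delta :: "nat \<Rightarrow> 'a::field mat set \<Rightarrow> 'a vec \<Rightarrow> 'a mat" where
  "delta n R v = linear_part (THE g. g \<in> R \<and> row g 0 = vCons 1 v) - 1\<^sub>m n"

definition delta_linear :: "nat \<Rightarrow> 'a::field mat set \<Rightarrow> bool" where
  "delta_linear n R \<longleftrightarrow>
     linear_map class_ring (module_vec TYPE('a) n) (module_mat TYPE('a) n n) (delta n R)"

text \<open>
  Row vectors are acted on from the right; \<open>v A\<close> is written \<open>A\<^sup>T v\<close>.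
\<close>

definition invariant_subspace :: "nat \<Rightarrow> 'a::field mat set \<Rightarrow> 'a vec set \<Rightarrow> bool" where
  "invariant_subspace n H W \<longleftrightarrow>
     VectorSpace.subspace class_ring W (module_vec TYPE('a) n) \<and>
     (\<forall>h\<in>H. \<forall>w\<in>W. transpose_mat (linear_part h) *\<^sub>v w \<in> W)"

definition indecomposable :: "nat \<Rightarrow> 'a::field mat set \<Rightarrow> bool" where
  "indecomposable n H \<longleftrightarrow>
     \<not> (\<exists>V W. invariant_subspace n H V \<and> invariant_subspace n H W \<and>
          V \<noteq> {0\<^sub>v n} \<and> W \<noteq> {0\<^sub>v n} \<and>
          V \<inter> W = {0\<^sub>v n} \<and> V <+>\<^bsub>module_vec TYPE('a) n\<^esub> W = carrier_vec n)"

section \<open>Conjugacy classes of subgroups\<close>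

definition conjugate_in :: "('a, 'b) monoid_scheme \<Rightarrow> 'a set \<Rightarrow> 'a set \<Rightarrow> bool" where
  "conjugate_in G H K \<longleftrightarrow> (\<exists>g\<in>carrier G. K = g <#\<^bsub>G\<^esub> H #>\<^bsub>G\<^esub> (inv\<^bsub>G\<^esub> g))"

definition conjugacy_representatives ::
    "('a, 'b) monoid_scheme \<Rightarrow> 'a set set \<Rightarrow> 'a set set \<Rightarrow> bool" where
  "conjugacy_representatives G X T \<longleftrightarrow>
     T \<subseteq> X \<and> (\<forall>U\<in>X. \<exists>!S. S \<in> T \<and> conjugate_in G U S)"

section \<open>Algebras\<close>

text \<open>The algebra \<open>\<F>I\<^sub>n\<^sub>+\<^sub>1 + U\<close> of matrices, for \<open>U \<subseteq> AGL\<^sub>n(\<F>)\<close>.\<close>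

definition matrix_algebra :: "nat \<Rightarrow> 'a::field mat set \<Rightarrow> ('a, 'a mat) module" where
  "matrix_algebra n U = (module_mat TYPE('a) (Suc n) (Suc n))
     \<lparr>carrier := {a \<cdot>\<^sub>m 1\<^sub>m (Suc n) + b \<cdot>\<^sub>m u | a b u. u \<in> U}\<rparr>"

definition poly_algebra :: "('a::field, 'a poly) module" where
  "poly_algebra = \<lparr>carrier = UNIV, mult = (*), one = 1, zero = 0, add = (+),
     smult = Polynomial.smult\<rparr>"

text \<open>
  Polynomials in commuting indeterminates indexed by the type \<open>'v\<close>: a finitely
  supported map from monomials to coefficients, a monomial being a finitely
  supported map from indeterminates to exponents.
\<close>

definition mpoly_algebra :: "('a::field, ('v \<Rightarrow>\<^sub>0 nat) \<Rightarrow>\<^sub>0 'a) module" where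
  "mpoly_algebra = \<lparr>carrier = UNIV, mult = (*), one = 1, zero = 0, add = (+),
     smult = (\<lambda>c. Poly_Mapping.map ((*) c))\<rparr>"

definition indet :: "'v \<Rightarrow> ('v \<Rightarrow>\<^sub>0 nat) \<Rightarrow>\<^sub>0 'a::field" where
  "indet i = Poly_Mapping.single (Poly_Mapping.single i 1) 1"

text \<open>
  The quotient ring together with the scalar multiplication
  \<open>c (I + x) = I + c x\<close>, written in the style of \<^const>\<open>rcoset_mult\<close>.
\<close>

definition quotient_algebra :: "('k, 'b) module \<Rightarrow> 'b set \<Rightarrow> ('k, 'b set) module" where
  "quotient_algebra A I = ring.extend (A Quot I)
     (module.fields (\<lambda>c X. \<Union>x\<in>X. I +>\<^bsub>A\<^esub> (c \<odot>\<^bsub>A\<^esub> x)))"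

text \<open>
  Both arguments are required to be (commutative) algebras, because \<^const>\<open>ring_hom\<close>
  does not by itself force its source to be closed under the operations.
\<close>

definition algebra_isomorphic ::
    "('k::field, 'b) module \<Rightarrow> ('k, 'c) module \<Rightarrow> bool" where
  "algebra_isomorphic A B \<longleftrightarrow>
     algebra class_ring A \<and> algebra class_ring B \<and>
     (\<exists>h\<in>ring_iso A B. \<forall>c. \<forall>x\<in>carrier A. h (c \<odot>\<^bsub>A\<^esub> x) = c \<odot>\<^bsub>B\<^esub> h x)"

section \<open>The two subgroups and the two quotient algebras\<close>

definition S3 :: "'a::field mat set" where
  "S3 = {mat_of_rows_list 3 [[1, x1, x2], [0, 1, x1], [0, 0, 1]] | x1 x2. True}"

definition S21 :: "'a::field mat set" where
  "S21 = {mat_of_rows_list 3 [[1, x1, x2], [0, 1, 0], [0, 0, 1]] | x1 x2. True}"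

definition truncated_poly_algebra :: "('a::field, 'a poly set) module" where
  "truncated_poly_algebra =
     quotient_algebra poly_algebra (Idl\<^bsub>poly_algebra\<^esub> {[:0, 1:] ^ 3})"

text \<open>
  The indeterminates \<open>t\<^sub>1\<close>, \<open>t\<^sub>2\<close> are indexed by the two-element type \<open>2\<close>, whose
  elements are \<open>1\<close> and \<open>2\<close> (the latter equals \<open>0\<close>).
\<close>

definition truncated_mpoly2_algebra :: "('a::field, ((2 \<Rightarrow>\<^sub>0 nat) \<Rightarrow>\<^sub>0 'a) set) module" where
  "truncated_mpoly2_algebra =
     (let J = Idl\<^bsub>mpoly_algebra\<^esub> {indet 1, indet 2}
      in quotient_algebra mpoly_algebra (ideal_prod mpoly_algebra J J))"

end

theory Submission
  imports Defs
begin

text \<open>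
  If \<open>U\<close> is regular and \<open>\<delta>\<close> is linear, then \<open>v \<cdot> w = v \<delta>(w)\<close> is an associative bilinear product on
  \<open>\<F>\<^sup>2\<close>, because closure of \<open>U\<close> says \<open>\<delta>(v) \<delta>(w) = \<delta>(v \<delta>(w))\<close>. Since every \<open>I + \<delta>(v)\<close> is invertible,
  scaling shows that no \<open>\<delta>(v)\<close> has a nonzero eigenvalue in \<open>\<F>\<close>; an invertible \<open>\<delta>(w)\<close> would make \<open>-I\<close> a
  value of \<open>\<delta>\<close>. So all \<open>\<delta>(v)\<close> are nilpotent, and then either \<open>\<delta> = 0\<close> or
  \<open>\<delta>(v) = \<phi>(v) N\<close> for a linear form \<open>\<phi>\<close> and a nilpotent \<open>N\<close> of rank one whose image lies in the kernel
  of \<open>\<phi>\<close>. In the second case a basis adapted to \<open>\<phi>\<close> and \<open>N\<close> conjugates \<open>U\<close> to \<open>S3\<close>. The algebra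
  isomorphisms read off the coefficients of low degree of a polynomial as matrix entries.
\<close>

section \<open>Explicit small matrices\<close>

definition mat3 :: "'a \<Rightarrow> 'a \<Rightarrow> 'a \<Rightarrow> 'a \<Rightarrow> 'a \<Rightarrow> 'a \<Rightarrow> 'a \<Rightarrow> 'a \<Rightarrow> 'a \<Rightarrow> 'a mat" where
  "mat3 a b c d e f g h i = mat_of_rows_list 3 [[a, b, c], [d, e, f], [g, h, i]]"

definition mat2 :: "'a \<Rightarrow> 'a \<Rightarrow> 'a \<Rightarrow> 'a \<Rightarrow> 'a mat" where
  "mat2 a b c d = mat_of_rows_list 2 [[a, b], [c, d]]"

definition vec2 :: "'a \<Rightarrow> 'a \<Rightarrow> 'a vec" where
  "vec2 x y = vec 2 (\<lambda>i. if i = 0 then x else y)"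

lemma less_3_iff: "i < 3 \<longleftrightarrow> i = 0 \<or> i = 1 \<or> i = (2::nat)"
  by auto

lemma less_2_iff: "i < 2 \<longleftrightarrow> i = 0 \<or> i = (1::nat)"
  by auto

lemma sum_upto_3: "sum f {0..<3} = f 0 + f 1 + f (2::nat)"
  by (simp add: numeral_3_eq_3 numeral_2_eq_2)

lemma sum_upto_2: "sum f {0..<2} = f 0 + f (1::nat)"
  by (simp add: numeral_2_eq_2)

lemma mat3_dim [simp]:
  "dim_row (mat3 a b c d e f g h i) = 3" "dim_col (mat3 a b c d e f g h i) = 3"
  "mat3 a b c d e f g h i \<in> carrier_mat 3 3"
  by (auto simp: mat3_def mat_of_rows_list_def)

lemma mat3_index [simp]:
  "mat3 a b c d e f g h i $$ (0, 0) = a" "mat3 a b c d e f g h i $$ (0, 1) = b"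
  "mat3 a b c d e f g h i $$ (0, 2) = c" "mat3 a b c d e f g h i $$ (1, 0) = d"
  "mat3 a b c d e f g h i $$ (1, 1) = e" "mat3 a b c d e f g h i $$ (1, 2) = f"
  "mat3 a b c d e f g h i $$ (2, 0) = g" "mat3 a b c d e f g h i $$ (2, 1) = h"
  "mat3 a b c d e f g h i $$ (2, 2) = i"
  by (auto simp: mat3_def mat_of_rows_list_def)

text \<open>Simplification rewrites the index \<open>1\<close> to \<open>Suc 0\<close>, so the entry
  rules are also required in that form.\<close>

lemmas mat3_index_Suc [simp] = mat3_index(2,4-6,8)[unfolded One_nat_def]

lemma mat3_eqI:
  assumes "A \<in> carrier_mat 3 3"
    "A $$ (0, 0) = a" "A $$ (0, 1) = b" "A $$ (0, 2) = c"
    "A $$ (1, 0) = d" "A $$ (1, 1) = e" "A $$ (1, 2) = f"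
    "A $$ (2, 0) = g" "A $$ (2, 1) = h" "A $$ (2, 2) = i"
  shows "A = mat3 a b c d e f g h i"
  by (rule eq_matI) (use assms in \<open>auto simp: less_3_iff simp del: One_nat_def\<close>)

lemma mat3_eq_iff:
  "mat3 a b c d e f g h i = mat3 a' b' c' d' e' f' g' h' i' \<longleftrightarrow>
    a = a' \<and> b = b' \<and> c = c' \<and> d = d' \<and> e = e' \<and> f = f' \<and> g = g' \<and> h = h' \<and> i = i'"
  by (metis mat3_index)

lemma mat3_mult:
  fixes a :: "'a::semiring_0"
  shows "mat3 a b c d e f g h i * mat3 a' b' c' d' e' f' g' h' i' =
    mat3 (a*a' + b*d' + c*g') (a*b' + b*e' + c*h') (a*c' + b*f' + c*i')
         (d*a' + e*d' + f*g') (d*b' + e*e' + f*h') (d*c' + e*f' + f*i')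
         (g*a' + h*d' + i*g') (g*b' + h*e' + i*h') (g*c' + h*f' + i*i')"
  by (rule mat3_eqI) (auto simp: scalar_prod_def sum_upto_3 add.assoc)

lemma mat3_add:
  "mat3 a b c d e f g h i + mat3 a' b' c' d' e' f' g' h' i' =
    mat3 (a + a') (b + b') (c + c') (d + d') (e + e') (f + f') (g + g') (h + h') (i + i')"
  by (rule mat3_eqI) (auto simp del: One_nat_def)

lemma mat3_smult:
  "r \<cdot>\<^sub>m mat3 a b c d e f g h i = mat3 (r*a) (r*b) (r*c) (r*d) (r*e) (r*f) (r*g) (r*h) (r*i)"
  by (rule mat3_eqI) (auto simp del: One_nat_def)

lemma mat3_one: "1\<^sub>m 3 = mat3 1 0 0 0 1 0 0 0 1"
  by (rule mat3_eqI) auto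

lemma mat3_zero: "0\<^sub>m 3 3 = mat3 0 0 0 0 0 0 0 0 0"
  by (rule mat3_eqI) auto

lemma mat2_dim [simp]:
  "dim_row (mat2 a b c d) = 2" "dim_col (mat2 a b c d) = 2" "mat2 a b c d \<in> carrier_mat 2 2"
  by (auto simp: mat2_def mat_of_rows_list_def)

lemma mat2_index [simp]:
  "mat2 a b c d $$ (0, 0) = a" "mat2 a b c d $$ (0, 1) = b"
  "mat2 a b c d $$ (1, 0) = c" "mat2 a b c d $$ (1, 1) = d"
  by (auto simp: mat2_def mat_of_rows_list_def)

lemmas mat2_index_Suc [simp] = mat2_index(2-4)[unfolded One_nat_def]

lemma mat2_eqI:
  assumes "A \<in> carrier_mat 2 2"
    "A $$ (0, 0) = a" "A $$ (0, 1) = b" "A $$ (1, 0) = c" "A $$ (1, 1) = d"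
  shows "A = mat2 a b c d"
  by (rule eq_matI) (use assms in \<open>auto simp: less_2_iff simp del: One_nat_def\<close>)

lemma mat2_eq_iff:
  "mat2 a b c d = mat2 a' b' c' d' \<longleftrightarrow> a = a' \<and> b = b' \<and> c = c' \<and> d = d'"
  by (metis mat2_index)

lemma mat2_add: "mat2 a b c d + mat2 a' b' c' d' = mat2 (a + a') (b + b') (c + c') (d + d')"
  by (rule mat2_eqI) (auto simp del: One_nat_def)

lemma mat2_smult: "r \<cdot>\<^sub>m mat2 a b c d = mat2 (r*a) (r*b) (r*c) (r*d)"
  by (rule mat2_eqI) (auto simp del: One_nat_def)

lemma mat2_minus_one:
  "mat2 a b c d - 1\<^sub>m 2 = mat2 (a - 1) b c (d - 1 :: 'a::ring_1)"
  by (rule mat2_eqI) auto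

lemma vec2_carrier [simp]: "vec2 x y \<in> carrier_vec 2"
  by (simp add: vec2_def)

lemma vec2_dim [simp]: "dim_vec (vec2 x y) = 2"
  by (simp add: vec2_def)

lemma vec2_index [simp]: "vec2 x y $ 0 = x" "vec2 x y $ 1 = y" "vec2 x y $ Suc 0 = y"
  by (simp_all add: vec2_def)

lemma vec2_eqI:
  assumes "v \<in> carrier_vec 2" "v $ 0 = x" "v $ 1 = y"
  shows "v = vec2 x y"
  by (rule eq_vecI) (use assms in \<open>auto simp: less_2_iff simp del: One_nat_def\<close>)

lemma vec2_cases:
  assumes "v \<in> carrier_vec 2"
  obtains x y where "v = vec2 x y"
  using vec2_eqI[OF assms] by blast

lemma vec2_eq_iff: "vec2 x y = vec2 x' y' \<longleftrightarrow> x = x' \<and> y = y'"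
  by (metis vec2_index(1,2))

lemma vec2_add: "vec2 x y + vec2 x' y' = vec2 (x + x') (y + y')"
  by (rule vec2_eqI) auto

lemma vec2_smult: "r \<cdot>\<^sub>v vec2 x y = vec2 (r*x) (r*y)"
  by (rule vec2_eqI) auto

lemma vec2_zero: "0\<^sub>v 2 = vec2 0 0"
  by (rule vec2_eqI) auto

text \<open>This is the right action of a matrix on a row vector, in the transposed form used by
  \<open>invariant_subspace\<close>.\<close>

lemma transpose_mat2_mult_vec2:
  fixes a :: "'a::comm_semiring_0"
  shows "transpose_mat (mat2 a b c d) *\<^sub>v vec2 x y = vec2 (x*a + y*c) (x*b + y*d)"
proof (rule vec2_eqI)
  show "transpose_mat (mat2 a b c d) *\<^sub>v vec2 x y \<in> carrier_vec 2"
    by (rule mult_mat_vec_carrier[of _ 2 2]) auto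
qed (auto simp: scalar_prod_def sum_upto_2 mult.commute)

lemma linear_part_mat3: "linear_part (mat3 a b c d e f g h i) = mat2 e f h i"
  unfolding linear_part_def mat_delete_def
  by (rule mat2_eqI) (auto simp: numeral_2_eq_2[symmetric])

lemma row_mat3: "row (mat3 a b c d e f g h i) 0 = vCons a (vec2 b c)"
proof (rule eq_vecI)
  fix k assume "k < dim_vec (vCons a (vec2 b c))"
  then have "k = 0 \<or> k = 1 \<or> k = 2"
    by auto
  then show "row (mat3 a b c d e f g h i) 0 $ k = vCons a (vec2 b c) $ k"
    by (auto simp: vec_index_vCons)
qed (simp add: numeral_3_eq_3)

lemma col_mat3_eq_unit_vec:
  "col (mat3 a b c d e f g h i) 0 = unit_vec 3 0 \<longleftrightarrow> a = 1 \<and> d = 0 \<and> g = 0"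
proof
  assume *: "col (mat3 a b c d e f g h i) 0 = unit_vec 3 0"
  have "col (mat3 a b c d e f g h i) 0 $ k = unit_vec 3 0 $ k" for k
    using * by simp
  from this[of 0] this[of 1] this[of 2] show "a = 1 \<and> d = 0 \<and> g = 0"
    by simp
next
  assume "a = 1 \<and> d = 0 \<and> g = 0"
  then show "col (mat3 a b c d e f g h i) 0 = unit_vec 3 0"
    by (intro eq_vecI) (auto simp: less_3_iff)
qed

lemma mat3_cases:
  assumes "A \<in> carrier_mat 3 3"
  obtains a b c d e f g h i where "A = mat3 a b c d e f g h i"
  using mat3_eqI[OF assms] by blast

section \<open>The affine group of the plane\<close>

lemma AGL_mult: "mult (AGL n) = (*)" and AGL_one: "one (AGL n) = 1\<^sub>m (Suc n)"
  by (auto simp: AGL_def GL_def units_of_def ring_mat_simps)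

lemma carrier_AGL:
  "carrier (AGL n) = {g \<in> carrier_mat (Suc n) (Suc n). col g 0 = unit_vec (Suc n) 0 \<and>
     (\<exists>h\<in>carrier_mat (Suc n) (Suc n). h * g = 1\<^sub>m (Suc n) \<and> g * h = 1\<^sub>m (Suc n))}"
  by (auto simp: AGL_def GL_def units_of_def ring_mat_simps Units_def)

text \<open>For a matrix with first row (1, v) and linear part A, the inverse has first row (1, -v
  A^-1) and linear part A^-1, with A^-1 the adjugate of A divided by its determinant
  \<open>D\<close>.\<close>

lemma affine_mat3_inverse:
  fixes x y a b c d :: "'a::field"
  assumes "a * d - b * c \<noteq> 0"
  obtains x' y' a' b' c' d' where "a' * d' - b' * c' \<noteq> 0"
    "mat3 1 x y 0 a b 0 c d * mat3 1 x' y' 0 a' b' 0 c' d' = 1\<^sub>m 3"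
    "mat3 1 x' y' 0 a' b' 0 c' d' * mat3 1 x y 0 a b 0 c d = 1\<^sub>m 3"
proof -
  define D where "D = a * d - b * c"
  have D: "D \<noteq> 0" using assms D_def by simp
  have "d / D * (a / D) - (- b / D) * (- c / D) = D / (D * D)"
    by (simp add: D_def diff_divide_distrib mult.commute)
  then have "d / D * (a / D) - (- b / D) * (- c / D) \<noteq> 0"
    using D by simp
  moreover have "mat3 1 x y 0 a b 0 c d * mat3 1 ((y * c - x * d) / D) ((x * b - y * a) / D)
      0 (d / D) (- b / D) 0 (- c / D) (a / D) = 1\<^sub>m 3"
    "mat3 1 ((y * c - x * d) / D) ((x * b - y * a) / D) 0 (d / D) (- b / D) 0 (- c / D) (a / D)
      * mat3 1 x y 0 a b 0 c d = 1\<^sub>m 3"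
    using D unfolding mat3_mult mat3_one mat3_eq_iff
    by (simp_all add: field_simps) (simp_all add: D_def field_simps)
  ultimately show thesis by (rule that)
qed

text \<open>The unit group becomes an explicit set: invertibility of the whole matrix is read off
  from the determinant of its linear part.\<close>

lemma carrier_AGL2:
  "carrier (AGL 2) = {mat3 1 x y 0 a b 0 c d | x y a b c d. a * d - b * c \<noteq> (0::'a::field)}"
proof (intro equalityI subsetI)
  fix g :: "'a mat" assume "g \<in> carrier (AGL 2)"
  then obtain h where g: "g \<in> carrier_mat 3 3" "col g 0 = unit_vec 3 0"
    and h: "h \<in> carrier_mat 3 3" "g * h = 1\<^sub>m 3"
    by (auto simp: carrier_AGL)
  obtain u x y v a b w c d where "g = mat3 u x y v a b w c d"
    using mat3_cases[OF g(1)] .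
  then have g': "g = mat3 1 x y 0 a b 0 c d"
    using g(2) by (simp add: col_mat3_eq_unit_vec)
  obtain h1 h2 h3 h4 h5 h6 h7 h8 h9 where h': "h = mat3 h1 h2 h3 h4 h5 h6 h7 h8 h9"
    using mat3_cases[OF h(1)] .
  have "a * h5 + b * h8 = 1" "a * h6 + b * h9 = 0" "c * h5 + d * h8 = 0" "c * h6 + d * h9 = 1"
    using h(2) by (auto simp: g' h' mat3_mult mat3_one mat3_eq_iff)
  \<comment> \<open>Multiplicativity of the 2x2 determinant. The lower rows of \<open>g\<close>
    start with 0, so the lower right block of \<open>g * h\<close> is the product of the lower right
    blocks.\<close>
  moreover have "(a * d - b * c) * (h5 * h9 - h6 * h8)
      = (a * h5 + b * h8) * (c * h6 + d * h9) - (a * h6 + b * h9) * (c * h5 + d * h8)"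
    by (simp add: algebra_simps)
  ultimately have "(a * d - b * c) * (h5 * h9 - h6 * h8) = 1"
    by simp
  then have "a * d - b * c \<noteq> 0"
    by auto
  then show "g \<in> {mat3 1 x y 0 a b 0 c d | x y a b c d. a * d - b * c \<noteq> 0}"
    using g' by blast
next
  fix g :: "'a mat" assume "g \<in> {mat3 1 x y 0 a b 0 c d | x y a b c d. a * d - b * c \<noteq> 0}"
  then obtain x y a b c d where g: "g = mat3 1 x y 0 a b 0 c d" "a * d - b * c \<noteq> 0"
    by blast
  obtain x' y' a' b' c' d' where
    "mat3 1 x y 0 a b 0 c d * mat3 1 x' y' 0 a' b' 0 c' d' = 1\<^sub>m 3"
    "mat3 1 x' y' 0 a' b' 0 c' d' * mat3 1 x y 0 a b 0 c d = 1\<^sub>m 3"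
    using affine_mat3_inverse[OF g(2)] by metis
  then have "\<exists>h\<in>carrier_mat 3 3. h * g = 1\<^sub>m 3 \<and> g * h = 1\<^sub>m 3"
    by (intro bexI[of _ "mat3 1 x' y' 0 a' b' 0 c' d'"]) (simp_all add: g(1))
  then show "g \<in> carrier (AGL 2)"
    by (simp add: carrier_AGL g(1) col_mat3_eq_unit_vec)
qed

lemma mat3_in_carrier_AGL2_iff:
  "mat3 u x y v a b w c d \<in> carrier (AGL 2) \<longleftrightarrow>
    u = 1 \<and> v = 0 \<and> w = 0 \<and> a * d - b * c \<noteq> (0::'a::field)"
  unfolding carrier_AGL2 by (auto simp: mat3_eq_iff)

lemma carrier_AGL2_cases:
  assumes "g \<in> carrier (AGL 2)"
  obtains x y a b c d where "g = mat3 1 x y 0 a b 0 c d" "a * d - b * c \<noteq> (0::'a::field)"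
  using assms unfolding carrier_AGL2 by blast

lemma group_AGL2: "group (AGL 2 :: 'a::field mat monoid)"
proof (rule groupI)
  fix g h :: "'a mat" assume "g \<in> carrier (AGL 2)" "h \<in> carrier (AGL 2)"
  then obtain x y a b c d x' y' a' b' c' d'
    where g: "g = mat3 1 x y 0 a b 0 c d" "a * d - b * c \<noteq> 0"
      and h: "h = mat3 1 x' y' 0 a' b' 0 c' d'" "a' * d' - b' * c' \<noteq> 0"
    unfolding carrier_AGL2 by blast
  \<comment> \<open>The determinant of the linear part is multiplicative, hence nonzero on
    products.\<close>
  have "(a * a' + b * c') * (c * b' + d * d') - (a * b' + b * d') * (c * a' + d * c')
      = (a * d - b * c) * (a' * d' - b' * c')"
    by (simp add: algebra_simps)
  then show "g \<otimes>\<^bsub>AGL 2\<^esub> h \<in> carrier (AGL 2)"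
    using g(2) h(2) unfolding g(1) h(1) AGL_mult mat3_mult mat3_in_carrier_AGL2_iff by simp
next
  show "\<one>\<^bsub>AGL 2\<^esub> \<in> carrier (AGL 2 :: 'a mat monoid)"
    by (simp add: AGL_one mat3_one mat3_in_carrier_AGL2_iff)
next
  fix g h k :: "'a mat" assume "g \<in> carrier (AGL 2)" "h \<in> carrier (AGL 2)" "k \<in> carrier (AGL 2)"
  then show "g \<otimes>\<^bsub>AGL 2\<^esub> h \<otimes>\<^bsub>AGL 2\<^esub> k = g \<otimes>\<^bsub>AGL 2\<^esub> (h \<otimes>\<^bsub>AGL 2\<^esub> k)"
    by (auto simp: AGL_mult carrier_AGL intro!: assoc_mult_mat)
next
  fix g :: "'a mat" assume g: "g \<in> carrier (AGL 2)"
  then show "\<one>\<^bsub>AGL 2\<^esub> \<otimes>\<^bsub>AGL 2\<^esub> g = g"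
    by (auto simp: AGL_mult AGL_one carrier_AGL)
  from g obtain x y a b c d where g: "g = mat3 1 x y 0 a b 0 c d" "a * d - b * c \<noteq> 0"
    by (rule carrier_AGL2_cases)
  obtain x' y' a' b' c' d' where "a' * d' - b' * c' \<noteq> 0"
    "mat3 1 x' y' 0 a' b' 0 c' d' * mat3 1 x y 0 a b 0 c d = 1\<^sub>m 3"
    using affine_mat3_inverse[OF g(2)] by metis
  then have "mat3 1 x' y' 0 a' b' 0 c' d' \<in> carrier (AGL 2)"
    "mat3 1 x' y' 0 a' b' 0 c' d' \<otimes>\<^bsub>AGL 2\<^esub> g = \<one>\<^bsub>AGL 2\<^esub>"
    by (simp_all add: AGL_mult AGL_one g(1) mat3_in_carrier_AGL2_iff)
  then show "\<exists>h\<in>carrier (AGL 2). h \<otimes>\<^bsub>AGL 2\<^esub> g = \<one>\<^bsub>AGL 2\<^esub>"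
    by blast
qed

lemma (in group) mem_conjugate_iff:
  assumes "g \<in> carrier G" "H \<subseteq> carrier G" "k \<in> carrier G"
  shows "k \<in> g <# H #> inv g \<longleftrightarrow> (\<exists>h\<in>H. g \<otimes> h = k \<otimes> g)"
proof -
  have "k \<in> g <# H #> inv g \<longleftrightarrow> (\<exists>h\<in>H. k = g \<otimes> h \<otimes> inv g)"
    by (auto simp: l_coset_def r_coset_def)
  also have "\<dots> \<longleftrightarrow> (\<exists>h\<in>H. g \<otimes> h = k \<otimes> g)"
    using assms by (intro bex_cong refl) (metis inv_solve_right m_closed subsetD inv_solve_right')
  finally show ?thesis .
qed

text \<open>Multiplying K = g H g^-1 by g on the right removes the inverse. For concrete matrices,
  conjugacy then becomes a matching of elements through the equations g h = k g.\<close>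

lemma (in group) conjugate_in_iff:
  assumes H: "H \<subseteq> carrier G" and K: "K \<subseteq> carrier G"
  shows "conjugate_in G H K \<longleftrightarrow> (\<exists>g\<in>carrier G.
    (\<forall>h\<in>H. \<exists>k\<in>K. g \<otimes> h = k \<otimes> g) \<and> (\<forall>k\<in>K. \<exists>h\<in>H. g \<otimes> h = k \<otimes> g))"
  unfolding conjugate_in_def
proof (intro bex_cong refl)
  fix g assume g: "g \<in> carrier G"
  have sub: "g <# H #> inv g \<subseteq> carrier G"
    using g H by (simp add: l_coset_subset_G r_coset_subset_G)
  have inj: "k = k'" if "k \<otimes> g = k' \<otimes> g" "k \<in> carrier G" "k' \<in> carrier G" for k k'
    using that g by simp
  have ex: "\<exists>k\<in>g <# H #> inv g. g \<otimes> h = k \<otimes> g" if "h \<in> H" for h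
  proof
    show "g \<otimes> h \<otimes> inv g \<in> g <# H #> inv g"
      using that by (auto simp: l_coset_def r_coset_def)
    show "g \<otimes> h = g \<otimes> h \<otimes> inv g \<otimes> g"
      using that g H by (simp add: m_assoc subsetD)
  qed
  show "K = g <# H #> inv g \<longleftrightarrow>
    (\<forall>h\<in>H. \<exists>k\<in>K. g \<otimes> h = k \<otimes> g) \<and> (\<forall>k\<in>K. \<exists>h\<in>H. g \<otimes> h = k \<otimes> g)"
    (is "?L \<longleftrightarrow> ?R")
  proof
    assume ?L
    then show ?R
      using ex mem_conjugate_iff[OF g H] K by blast
  next
    assume ?R
    show ?L
    proof (intro equalityI subsetI)
      fix k assume "k \<in> K"
      then show "k \<in> g <# H #> inv g"
        using \<open>?R\<close> mem_conjugate_iff[OF g H] K by blast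
    next
      fix k assume k: "k \<in> g <# H #> inv g"
      then obtain h where h: "h \<in> H" "g \<otimes> h = k \<otimes> g"
        using mem_conjugate_iff[OF g H] sub by blast
      then obtain k' where "k' \<in> K" "g \<otimes> h = k' \<otimes> g"
        using \<open>?R\<close> by blast
      then show "k \<in> K"
        using h inj[of k k'] k sub K by auto
    qed
  qed
qed

section \<open>Regular subgroups with linear delta\<close>

text \<open>In a group a left inverse is the inverse, so it suffices to exhibit one inside
  \<open>H\<close>.\<close>

lemma subgroup_AGL2I:
  assumes "H \<subseteq> carrier (AGL 2)" "1\<^sub>m 3 \<in> H"
    and mult: "\<And>g h. g \<in> H \<Longrightarrow> h \<in> H \<Longrightarrow> g * h \<in> H"
    and inv: "\<And>g. g \<in> H \<Longrightarrow> \<exists>h\<in>H. h * g = 1\<^sub>m 3"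
  shows "subgroup H (AGL 2 :: 'a::field mat monoid)"
proof -
  interpret group "AGL 2 :: 'a mat monoid" by (rule group_AGL2)
  show ?thesis
  proof (rule subgroupI)
    show "H \<noteq> {}" using assms(2) by blast
    fix g assume g: "g \<in> H"
    then obtain h where h: "h \<in> H" "h * g = 1\<^sub>m 3" using inv by blast
    then have "inv\<^bsub>AGL 2\<^esub> g = h"
      using g assms(1) by (intro inv_equality) (auto simp: AGL_mult AGL_one)
    then show "inv\<^bsub>AGL 2\<^esub> g \<in> H" using h by simp
  qed (use assms in \<open>auto simp: AGL_mult\<close>)
qed

text \<open>The conjugating element is replaced by its inverse. \<open>conjugate_in_S21_iff\<close>
  has \<open>S21\<close> only as the target; symmetry lets it also exclude a conjugation from
  \<open>S21\<close> to \<open>S3\<close>.\<close>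

lemma (in group) conjugate_in_sym:
  assumes H: "H \<subseteq> carrier G" and K: "K \<subseteq> carrier G" and "conjugate_in G H K"
  shows "conjugate_in G K H"
proof -
  obtain g where g: "g \<in> carrier G" "\<forall>h\<in>H. \<exists>k\<in>K. g \<otimes> h = k \<otimes> g" "\<forall>k\<in>K. \<exists>h\<in>H. g \<otimes> h = k \<otimes> g"
    using assms(3) unfolding conjugate_in_iff[OF H K] by blast
  have "inv g \<otimes> k = h \<otimes> inv g" if "g \<otimes> h = k \<otimes> g" "h \<in> carrier G" "k \<in> carrier G" for h k
  proof -
    have "inv g \<otimes> k = inv g \<otimes> (k \<otimes> g) \<otimes> inv g"
      using g(1) that by (simp add: m_assoc)
    also have "\<dots> = inv g \<otimes> (g \<otimes> h) \<otimes> inv g"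
      by (simp only: that(1))
    also have "\<dots> = h \<otimes> inv g"
      using g(1) that(2) by (simp only: m_assoc[symmetric] inv_closed l_inv l_one)
    finally show ?thesis .
  qed
  then have swap: "inv g \<otimes> k = h \<otimes> inv g" if "g \<otimes> h = k \<otimes> g" "h \<in> H" "k \<in> K" for h k
    using that H K by blast
  show ?thesis
    unfolding conjugate_in_iff[OF K H]
  proof (rule bexI[of _ "inv g"], intro conjI ballI)
    show "\<exists>h\<in>H. inv g \<otimes> k = h \<otimes> inv g" if "k \<in> K" for k
      using g(3) swap that by blast
    show "\<exists>k\<in>K. inv g \<otimes> k = h \<otimes> inv g" if "h \<in> H" for h
      using g(2) swap that by blast
    show "inv g \<in> carrier G"
      using g(1) by simp
  qed
qed

lemma regular_subgroup_2D:
  assumes "regular_subgroup 2 (U :: 'a::field mat set)"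
  shows "U \<subseteq> carrier (AGL 2)" "\<And>g h. g \<in> U \<Longrightarrow> h \<in> U \<Longrightarrow> g * h \<in> U"
    "\<And>x y. \<exists>!g. g \<in> U \<and> row g 0 = vCons 1 (vec2 x y)"
proof -
  have *: "subgroup U (AGL 2)" "\<forall>v\<in>carrier_vec 2. \<exists>!g. g \<in> U \<and> row g 0 = vCons 1 v"
    using assms by (auto simp: regular_subgroup_def)
  show "U \<subseteq> carrier (AGL 2)" using *(1) by (rule subgroup.subset)
  show "g * h \<in> U" if "g \<in> U" "h \<in> U" for g h
    using subgroup.m_closed[OF *(1) that] by (simp add: AGL_mult)
  show "\<exists>!g. g \<in> U \<and> row g 0 = vCons 1 (vec2 x y)" for x y
    using *(2) by simp
qed

text \<open>By uniqueness in regularity, the definite description in \<open>delta\<close> picks any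
  element of \<open>U\<close> already known to have this first row.\<close>

lemma delta_2_eq:
  assumes "regular_subgroup 2 U" "mat3 1 x y 0 a b 0 c d \<in> U"
  shows "delta 2 U (vec2 x y) = mat2 (a - 1) b c (d - 1 :: 'a::field)"
proof -
  have "(THE g. g \<in> U \<and> row g 0 = vCons 1 (vec2 x y)) = mat3 1 x y 0 a b 0 c d"
    using assms regular_subgroup_2D(3)[OF assms(1), of x y] by (intro the1_equality) (auto simp: row_mat3)
  then show ?thesis
    by (simp add: delta_def linear_part_mat3 mat2_minus_one)
qed

text \<open>The linear part is I + x A + y B, where A has the entries \<open>a1\<close> to
  \<open>a4\<close> and B the entries \<open>b1\<close> to \<open>b4\<close>, row by row. For linear
  \<delta> these are the values A = \<delta>(1, 0) and B = \<delta>(0, 1).\<close>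

definition affine_family ::
  "'a \<Rightarrow> 'a \<Rightarrow> 'a \<Rightarrow> 'a \<Rightarrow> 'a \<Rightarrow> 'a \<Rightarrow> 'a \<Rightarrow> 'a \<Rightarrow> 'a \<Rightarrow> 'a \<Rightarrow> 'a::field mat" where
  "affine_family a1 a2 a3 a4 b1 b2 b3 b4 x y =
     mat3 1 x y
          0 (1 + (x * a1 + y * b1)) (x * a2 + y * b2)
          0 (x * a3 + y * b3) (1 + (x * a4 + y * b4))"

text \<open>A linear map is determined by its values on the two standard basis vectors; conversely,
  any such formula is linear.\<close>

lemma delta_linear_2_iff:
  "delta_linear 2 (U :: 'a::field mat set) \<longleftrightarrow> (\<exists>a1 a2 a3 a4 b1 b2 b3 b4. \<forall>x y. delta 2 U (vec2 x y) =
     mat2 (x * a1 + y * b1) (x * a2 + y * b2) (x * a3 + y * b3) (x * a4 + y * b4))"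
    (is "?L \<longleftrightarrow> ?R")
proof
  assume ?L
  then have hom: "delta 2 U \<in> LinearCombinations.module_hom class_ring (module_vec TYPE('a) 2) (module_mat TYPE('a) 2 2)"
    unfolding delta_linear_def linear_map_def mod_hom_def mod_hom_axioms_def by blast
  have add: "delta 2 U (v + w) = delta 2 U v + delta 2 U w" if "v \<in> carrier_vec 2" "w \<in> carrier_vec 2" for v w
    using LinearCombinations.module_hom_add[OF hom] that by (simp add: module_vec_simps module_mat_simps)
  have smult: "delta 2 U (r \<cdot>\<^sub>v v) = r \<cdot>\<^sub>m delta 2 U v" if "v \<in> carrier_vec 2" for r v
    using LinearCombinations.module_hom_smult[OF hom] that by (simp add: module_vec_simps module_mat_simps)
  have carr: "delta 2 U v \<in> carrier_mat 2 2" if "v \<in> carrier_vec 2" for v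
    using hom that by (auto simp: LinearCombinations.module_hom_def module_vec_simps module_mat_simps)
  obtain a1 a2 a3 a4 where a: "delta 2 U (vec2 1 0) = mat2 a1 a2 a3 a4"
    using mat2_eqI[OF carr[of "vec2 1 0"]] by fastforce
  obtain b1 b2 b3 b4 where b: "delta 2 U (vec2 0 1) = mat2 b1 b2 b3 b4"
    using mat2_eqI[OF carr[of "vec2 0 1"]] by fastforce
  have "delta 2 U (vec2 x y) =
     mat2 (x * a1 + y * b1) (x * a2 + y * b2) (x * a3 + y * b3) (x * a4 + y * b4)" for x y
  proof -
    have "vec2 x y = x \<cdot>\<^sub>v vec2 1 0 + y \<cdot>\<^sub>v vec2 0 1"
      by (simp add: vec2_smult vec2_add)
    then have "delta 2 U (vec2 x y) = x \<cdot>\<^sub>m delta 2 U (vec2 1 0) + y \<cdot>\<^sub>m delta 2 U (vec2 0 1)"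
      by (simp add: add smult)
    then show ?thesis
      by (simp add: a b mat2_smult mat2_add)
  qed
  then show ?R by blast
next
  assume ?R
  then obtain a1 a2 a3 a4 b1 b2 b3 b4 where eq: "\<And>x y. delta 2 U (vec2 x y) =
     mat2 (x * a1 + y * b1) (x * a2 + y * b2) (x * a3 + y * b3) (x * a4 + y * b4)"
    by blast
  have "delta 2 U \<in> LinearCombinations.module_hom class_ring (module_vec TYPE('a) 2) (module_mat TYPE('a) 2 2)"
    unfolding LinearCombinations.module_hom_def module_vec_simps module_mat_simps
    by (auto elim!: vec2_cases simp: vec2_add vec2_smult mat2_add mat2_smult eq mat2_eq_iff algebra_simps)
  then show ?L
    unfolding delta_linear_def
    by (intro linear_map.intro mod_hom.intro mod_hom_axioms.intro vec_vs matrix_vs vec_module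
        vectorspace.axioms(1)[OF matrix_vs])
qed

text \<open>An element of \<open>U\<close> is determined by its first row, and \<delta> supplies the
  linear part; by regularity every first row (1, x, y) occurs. So \<open>U\<close> is encoded by
  eight scalars.\<close>

lemma regular_delta_linear_2_eq_range:
  assumes "regular_subgroup 2 (U :: 'a::field mat set)" "delta_linear 2 U"
  obtains a1 a2 a3 a4 b1 b2 b3 b4
  where "U = {affine_family a1 a2 a3 a4 b1 b2 b3 b4 x y | x y. True}"
proof -
  obtain a1 a2 a3 a4 b1 b2 b3 b4 where eq: "\<And>x y. delta 2 U (vec2 x y) =
     mat2 (x * a1 + y * b1) (x * a2 + y * b2) (x * a3 + y * b3) (x * a4 + y * b4)"
    using assms(2) unfolding delta_linear_2_iff by blast
  have mem: "g = affine_family a1 a2 a3 a4 b1 b2 b3 b4 x y"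
    if g: "g \<in> U" "row g 0 = vCons 1 (vec2 x y)" for g x y
  proof -
    obtain x' y' a b c d where g': "g = mat3 1 x' y' 0 a b 0 c d"
      using g regular_subgroup_2D(1)[OF assms(1)] by (metis carrier_AGL2_cases subsetD)
    then have "x' = x" "y' = y"
      using g(2) by (auto simp: row_mat3 vec2_eq_iff)
    then have "mat2 (a - 1) b c (d - 1) = delta 2 U (vec2 x y)"
      using delta_2_eq[OF assms(1)] g(1) g' by metis
    then have "a - 1 = x * a1 + y * b1" "b = x * a2 + y * b2" "c = x * a3 + y * b3" "d - 1 = x * a4 + y * b4"
      by (simp_all add: eq mat2_eq_iff)
    then show ?thesis
      unfolding affine_family_def g' mat3_eq_iff using \<open>x' = x\<close> \<open>y' = y\<close> by (auto simp: algebra_simps)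
  qed
  have "U = {affine_family a1 a2 a3 a4 b1 b2 b3 b4 x y | x y. True}"
  proof (intro equalityI subsetI)
    fix g assume "g \<in> U"
    moreover from this obtain x y a b c d where "g = mat3 1 x y 0 a b 0 c d"
      using regular_subgroup_2D(1)[OF assms(1)] by (metis carrier_AGL2_cases subsetD)
    ultimately have "g = affine_family a1 a2 a3 a4 b1 b2 b3 b4 x y"
      by (intro mem) (simp_all add: row_mat3)
    then show "g \<in> {affine_family a1 a2 a3 a4 b1 b2 b3 b4 x y | x y. True}"
      by blast
  next
    fix g assume "g \<in> {affine_family a1 a2 a3 a4 b1 b2 b3 b4 x y | x y. True}"
    then obtain x y where g: "g = affine_family a1 a2 a3 a4 b1 b2 b3 b4 x y" by blast
    obtain h where "h \<in> U" "row h 0 = vCons 1 (vec2 x y)"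
      using regular_subgroup_2D(3)[OF assms(1), of x y] by blast
    with mem g show "g \<in> U" by metis
  qed
  then show ?thesis by (rule that)
qed

lemma regular_subgroup_2I:
  fixes f :: "'a::field \<Rightarrow> 'a \<Rightarrow> 'a mat"
  assumes sub: "subgroup U (AGL 2)" and U: "U = {f x y | x y. True}"
    and row: "\<And>x y. row (f x y) 0 = vCons 1 (vec2 x y)"
  shows "regular_subgroup 2 U"
  unfolding regular_subgroup_def
proof (intro conjI ballI sub)
  fix v :: "'a vec" assume "v \<in> carrier_vec 2"
  then obtain x y where v: "v = vec2 x y" by (rule vec2_cases)
  have *: "g = f x y" if "g \<in> U" "row g 0 = vCons 1 (vec2 x y)" for g
  proof -
    obtain x' y' where g: "g = f x' y'" using \<open>g \<in> U\<close> U by blast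
    then have "x' = x" "y' = y" using that(2) row by (auto simp: vec2_eq_iff)
    then show ?thesis using g by simp
  qed
  show "\<exists>!g. g \<in> U \<and> row g 0 = vCons 1 v"
    unfolding v by (rule ex1I[of _ "f x y"]) (use * U row in auto)
qed

section \<open>The two model groups: regularity, linearity and conjugates of the translation
  group\<close>

lemma S3_eq: "S3 = {mat3 1 x y 0 1 x 0 0 1 | x y. True}"
  by (simp add: S3_def mat3_def)

lemma S21_eq: "S21 = {mat3 1 x y 0 1 0 0 0 1 | x y. True}"
  by (simp add: S21_def mat3_def)

lemma regular_S3: "regular_subgroup 2 (S3 :: 'a::field mat set)"
proof (rule regular_subgroup_2I[OF _ S3_eq])
  show "subgroup S3 (AGL 2 :: 'a mat monoid)"
  proof (rule subgroup_AGL2I)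
    fix g :: "'a mat" assume "g \<in> S3"
    then obtain x y where g: "g = mat3 1 x y 0 1 x 0 0 1" by (auto simp: S3_eq)
    \<comment> \<open>With N = g - I and N^3 = 0, the inverse is I - N + N^2.\<close>
    have "mat3 1 (- x) (x * x - y) 0 1 (- x) 0 0 1 * g = 1\<^sub>m 3"
      by (simp add: g mat3_mult mat3_one mat3_eq_iff)
    moreover have "mat3 1 (- x) (x * x - y) 0 1 (- x) 0 0 1 \<in> S3"
      by (auto simp: S3_eq mat3_eq_iff)
    ultimately show "\<exists>h\<in>S3. h * g = 1\<^sub>m 3" by blast
  qed (auto simp: S3_eq mat3_mult mat3_one mat3_in_carrier_AGL2_iff mat3_eq_iff add_ac)
qed (simp add: row_mat3)

lemma regular_S21: "regular_subgroup 2 (S21 :: 'a::field mat set)"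
proof (rule regular_subgroup_2I[OF _ S21_eq])
  show "subgroup S21 (AGL 2 :: 'a mat monoid)"
  proof (rule subgroup_AGL2I)
    fix g :: "'a mat" assume "g \<in> S21"
    then obtain x y where g: "g = mat3 1 x y 0 1 0 0 0 1" by (auto simp: S21_eq)
    have "mat3 1 (- x) (- y) 0 1 0 0 0 1 * g = 1\<^sub>m 3"
      by (simp add: g mat3_mult mat3_one mat3_eq_iff)
    moreover have "mat3 1 (- x) (- y) 0 1 0 0 0 1 \<in> S21"
      by (auto simp: S21_eq mat3_eq_iff)
    ultimately show "\<exists>h\<in>S21. h * g = 1\<^sub>m 3" by blast
  qed (auto simp: S21_eq mat3_mult mat3_one mat3_in_carrier_AGL2_iff mat3_eq_iff add_ac)
qed (simp add: row_mat3)

lemma delta_S3: "delta 2 S3 (vec2 x y) = mat2 0 x 0 (0::'a::field)"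
  using delta_2_eq[OF regular_S3, of x y 1 x 0 1] by (auto simp: S3_eq)

lemma delta_S21: "delta 2 S21 (vec2 x y) = mat2 0 0 0 (0::'a::field)"
  using delta_2_eq[OF regular_S21, of x y 1 0 0 1] by (auto simp: S21_eq)

lemma delta_linear_S3: "delta_linear 2 (S3 :: 'a::field mat set)"
  unfolding delta_linear_2_iff delta_S3 mat2_eq_iff
  \<comment> \<open>Only the coefficient \<open>a2\<close> is 1: \<delta>(x, y) is x times the upper
    right matrix unit.\<close>
  by (rule exI[of _ 0], rule exI[of _ 1]) (auto intro!: exI[of _ 0])

lemma delta_linear_S21: "delta_linear 2 (S21 :: 'a::field mat set)"
  unfolding delta_linear_2_iff delta_S21 mat2_eq_iff
  by (auto intro!: exI[of _ 0])

lemma S3_neq_S21: "(S3 :: 'a::field mat set) \<noteq> S21"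
proof
  assume *: "(S3 :: 'a mat set) = S21"
  have "mat3 1 1 0 0 1 1 0 0 1 \<in> (S3 :: 'a mat set)" by (auto simp: S3_eq)
  then show False unfolding * by (auto simp: S21_eq mat3_eq_iff)
qed

text \<open>\<open>S21\<close> is the translation group, which is normal in the affine group.\<close>

lemma conjugate_in_S21_iff:
  assumes H: "H \<subseteq> carrier (AGL 2)"
  shows "conjugate_in (AGL 2) H (S21 :: 'a::field mat set) \<longleftrightarrow> H = S21"
proof -
  interpret group "AGL 2 :: 'a mat monoid" by (rule group_AGL2)
  have S21: "S21 \<subseteq> carrier (AGL 2 :: 'a mat monoid)"
    by (rule regular_subgroup_2D(1)[OF regular_S21])
  have to_right: "\<exists>k\<in>S21. g * t = k * g" and to_left: "\<exists>k\<in>S21. g * k = t * g"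
    if g: "g \<in> carrier (AGL 2)" and t: "t \<in> S21" for g t :: "'a mat"
  proof -
    obtain x y a b c d where g': "g = mat3 1 x y 0 a b 0 c d" "a * d - b * c \<noteq> 0"
      using g by (rule carrier_AGL2_cases)
    obtain u v where t': "t = mat3 1 u v 0 1 0 0 0 1" using t by (auto simp: S21_eq)
    define D where "D = a * d - b * c"
    have "D \<noteq> 0" using g' D_def by simp
    \<comment> \<open>Conjugation acts on translations through the linear part A of
      \<open>g\<close>: translation by w becomes translation by w A^-1 under g t g^-1, and by w A
      under g^-1 t g. The quotients by \<open>D\<close> are the coordinates of w A^-1 for w = (u,
      v).\<close>
    have "(u * d - v * c) / D * a + (v * a - u * b) / D * c = u * D / D"
      unfolding add_divide_distrib[symmetric] times_divide_eq_left by (simp add: D_def algebra_simps)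
    moreover have "(u * d - v * c) / D * b + (v * a - u * b) / D * d = v * D / D"
      unfolding add_divide_distrib[symmetric] times_divide_eq_left by (simp add: D_def algebra_simps)
    ultimately have "g * t = mat3 1 ((u * d - v * c) / D) ((v * a - u * b) / D) 0 1 0 0 0 1 * g"
      using \<open>D \<noteq> 0\<close> by (simp add: g' t' mat3_mult mat3_eq_iff algebra_simps)
    then show "\<exists>k\<in>S21. g * t = k * g" by (auto simp: S21_eq)
    have "g * mat3 1 (u * a + v * c) (u * b + v * d) 0 1 0 0 0 1 = t * g"
      by (simp add: g' t' mat3_mult mat3_eq_iff algebra_simps)
    then show "\<exists>k\<in>S21. g * k = t * g" by (auto simp: S21_eq)
  qed
  have cancel: "h = t" if "g * h = g * t" "g \<in> carrier (AGL 2)" "h \<in> carrier (AGL 2)" "t \<in> carrier (AGL 2)"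
    for g h t :: "'a mat"
    using that Units_l_cancel[of g h t] by (simp add: AGL_mult)
  show ?thesis
  proof
    assume "conjugate_in (AGL 2) H (S21 :: 'a mat set)"
    then obtain g where g: "g \<in> carrier (AGL 2)" "\<forall>h\<in>H. \<exists>k\<in>S21. g * h = k * g"
      "\<forall>k\<in>S21. \<exists>h\<in>H. g * h = k * g"
      using conjugate_in_iff[OF H S21] by (auto simp: AGL_mult)
    show "H = S21"
    proof (intro equalityI subsetI)
      fix h assume h: "h \<in> H"
      with g(2) obtain k where "k \<in> S21" "g * h = k * g" by blast
      \<comment> \<open>Both \<open>h\<close> and the translation \<open>t\<close> solve g X = k g,
        so cancelling \<open>g\<close> identifies them.\<close>
      moreover from this to_left[OF g(1)] obtain t where "t \<in> S21" "g * t = k * g" by blast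
      ultimately show "h \<in> S21" using cancel[of g h t] g(1) h H S21 by auto
    next
      fix t :: "'a mat" assume t: "t \<in> S21"
      with to_right[OF g(1)] obtain k where "k \<in> S21" "g * t = k * g" by blast
      moreover from this g(3) obtain h where "h \<in> H" "g * h = k * g" by blast
      ultimately show "t \<in> H" using cancel[of g h t] g(1) t H S21 by auto
    qed
  next
    assume "H = S21"
    then show "conjugate_in (AGL 2) H S21"
      unfolding conjugate_in_iff[OF H S21] AGL_mult
      using to_left to_right one_closed by blast
  qed
qed

text \<open>Every nonzero invariant subspace contains the vector (0, 1), so two of them cannot meet
  in 0 only.\<close>

lemma indecomposable_S3: "indecomposable 2 (S3 :: 'a::field mat set)"
proof -
  have e2: "vec2 0 1 \<in> W" if W: "invariant_subspace 2 S3 W" "W \<noteq> {0\<^sub>v 2}" for W :: "'a vec set"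
  proof -
    have sub: "submodule class_ring W (module_vec TYPE('a) 2)"
      using W(1) unfolding invariant_subspace_def VectorSpace.subspace_def by blast
    note subD = submodule.subset[OF sub] submodule.m_closed[OF sub] submodule.zero_closed[OF sub]
      submodule.smult_closed[OF sub]
    have add: "v + w \<in> W" if "v \<in> W" "w \<in> W" for v w
      using subD(2) that by (simp add: module_vec_simps)
    have smult: "r \<cdot>\<^sub>v w \<in> W" if "w \<in> W" for r w
      using subD(4) that by (simp add: module_vec_simps)
    have "0\<^sub>v 2 \<in> W"
      using subD(3) by (simp add: module_vec_simps)
    then obtain w where w: "w \<in> W" "w \<noteq> 0\<^sub>v 2"
      using W(2) by blast
    then obtain a b where ab: "w = vec2 a b"
      using subD(1) by (metis module_vec_simps(3) subsetD vec2_cases)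
    show ?thesis
    proof (cases "a = 0")
      case True
      then have "b \<noteq> 0" using w ab by (auto simp: vec2_zero)
      then show ?thesis using smult[OF w(1), of "inverse b"] True by (simp add: ab vec2_smult)
    next
      case False
      \<comment> \<open>The element with x1 = 1 maps w = (a, b) to (a, a + b). Subtracting w leaves
        (0, a), which is then divided by a.\<close>
      have "mat3 1 1 0 0 1 1 0 0 1 \<in> (S3 :: 'a mat set)" by (auto simp: S3_eq)
      then have "transpose_mat (mat2 1 1 0 1) *\<^sub>v w \<in> W"
        using W(1) w(1) unfolding invariant_subspace_def by (metis linear_part_mat3)
      then have "vec2 a (a + b) \<in> W"
        by (simp add: ab transpose_mat2_mult_vec2)
      from smult[OF add[OF this smult[OF w(1), of "-1"]], of "inverse a"] False
      show ?thesis by (simp add: ab vec2_smult vec2_add)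
    qed
  qed
  have "vec2 0 1 \<noteq> (0\<^sub>v 2 :: 'a vec)" by (simp add: vec2_zero vec2_eq_iff)
  then show ?thesis
    unfolding indecomposable_def using e2 by blast
qed

section \<open>Classification of the regular subgroups with linear \<delta>\<close>

text \<open>Here \<delta>(x, y) has rows (p, q) and (r, s). The hypotheses \<open>mult\<close> are
  the entries of \<delta>(v) \<delta>(w) = \<delta>(v \<delta>(w)), and the conclusion, vanishing
  determinant and trace, is nilpotency of \<delta>(x, y).\<close>

lemma mat2_family_nilpotent:
  fixes p q r s :: "'a::field \<Rightarrow> 'a \<Rightarrow> 'a"
  assumes mult: "\<And>x y x' y'.
      p x y * p x' y' + q x y * r x' y' = p (x * p x' y' + y * r x' y') (x * q x' y' + y * s x' y')"
      "\<And>x y x' y'.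
      p x y * q x' y' + q x y * s x' y' = q (x * p x' y' + y * r x' y') (x * q x' y' + y * s x' y')"
      "\<And>x y x' y'.
      r x y * p x' y' + s x y * r x' y' = r (x * p x' y' + y * r x' y') (x * q x' y' + y * s x' y')"
      "\<And>x y x' y'.
      r x y * q x' y' + s x y * s x' y' = s (x * p x' y' + y * r x' y') (x * q x' y' + y * s x' y')"
    and scale: "\<And>c x y. p (c * x) (c * y) = c * p x y" "\<And>c x y. q (c * x) (c * y) = c * q x y"
      "\<And>c x y. r (c * x) (c * y) = c * r x y" "\<And>c x y. s (c * x) (c * y) = c * s x y"
    and invertible: "\<And>x y. (1 + p x y) * (1 + s x y) - q x y * r x y \<noteq> 0"
  shows "p x y * s x y - q x y * r x y = 0" "p x y + s x y = 0"
proof -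
  define D where "D = p x y * s x y - q x y * r x y"
  show D0: "p x y * s x y - q x y * r x y = 0"
  proof (rule ccontr)
    assume "\<not> ?thesis"
    then have D: "D \<noteq> 0" by (simp add: D_def)
    txt \<open>Solve \<open>(u, v) \<delta>(x, y) = (x, y)\<close>; then \<open>\<delta>(u, v) = I\<close>, so \<open>I + \<delta>(-u, -v) = 0\<close>.\<close>
    define u v where "u = (x * s x y - y * r x y) / D" and "v = (y * p x y - x * q x y) / D"
    have "u * p x y + v * r x y = x * D / D" "u * q x y + v * s x y = y * D / D"
      unfolding u_def v_def times_divide_eq_left add_divide_distrib[symmetric]
      by (simp_all add: D_def algebra_simps)
    then have uv: "u * p x y + v * r x y = x" "u * q x y + v * s x y = y"
      using D by simp_all
    have eqs: "p u v * p x y + q u v * r x y = p x y" "p u v * q x y + q u v * s x y = q x y"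
      "r u v * p x y + s u v * r x y = r x y" "r u v * q x y + s u v * s x y = s x y"
      using mult[of u v x y] unfolding uv by simp_all
    \<comment> \<open>The equation \<delta>(u, v) \<delta>(x, y) = \<delta>(x, y) is multiplied by
      the adjugate of \<delta>(x, y), or the adjugate is applied to combinations of its entries, to
      isolate single entries of \<delta>(u, v) times \<open>D\<close>.\<close>
    have "(p u v * p x y + q u v * r x y) * s x y - (p u v * q x y + q u v * s x y) * r x y = p u v * D"
      "p x y * (r u v * q x y + s u v * s x y) - q x y * (r u v * p x y + s u v * r x y) = s u v * D"
      "p x y * (p u v * q x y + q u v * s x y) - q x y * (p u v * p x y + q u v * r x y) = q u v * D"
      by (simp_all add: D_def algebra_simps)
    then have "D = p u v * D" "D = s u v * D" "0 = q u v * D"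
      unfolding eqs D_def[symmetric] by (simp_all add: mult.commute)
    then have "p u v = 1" "s u v = 1" "q u v = 0"
      using D by simp_all
    \<comment> \<open>Both diagonal entries of I + \<delta>(-u, -v) vanish and so does its upper
      right entry; this already makes the determinant 0, whatever \<open>r u v\<close> is.\<close>
    then have "(1 + p (-1 * u) (-1 * v)) * (1 + s (-1 * u) (-1 * v))
        - q (-1 * u) (-1 * v) * r (-1 * u) (-1 * v) = 0"
      unfolding scale by simp
    then show False using invertible by blast
  qed
  show "p x y + s x y = 0"
  proof (rule ccontr)
    assume t: "p x y + s x y \<noteq> 0"
    define t where "t = p x y + s x y"
    \<comment> \<open>In general det(I + c \<delta>) = 1 + c t + c^2 det \<delta>. Since det
      \<delta> = 0, the choice c = -1/t gives a singular matrix.\<close>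
    have "(1 + p (- 1 / t * x) (- 1 / t * y)) * (1 + s (- 1 / t * x) (- 1 / t * y))
        - q (- 1 / t * x) (- 1 / t * y) * r (- 1 / t * x) (- 1 / t * y)
        = 1 - (p x y + s x y) / t + (p x y * s x y - q x y * r x y) / (t * t)"
      unfolding scale by (simp add: algebra_simps add_divide_distrib diff_divide_distrib)
    also have "\<dots> = 0"
      unfolding D0 using t by (simp add: t_def)
    finally show False using invertible by blast
  qed
qed

text \<open>The second alternative says \<delta>(v) = \<phi>(v) N with \<phi>(x, y) = \<alpha> x +
  \<beta> y and N equal to k times the column (\<alpha>, \<beta>) times the row (-\<beta>,
  \<alpha>). The image of N, spanned by (-\<beta>, \<alpha>), is the kernel of \<phi>. The vector
  (p, q) satisfies \<phi>(p, q) = 1, so \<phi> is nonzero.\<close>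

lemma affine_family_normal_form:
  fixes a1 a2 a3 a4 b1 b2 b3 b4 :: "'a::field"
  defines "U \<equiv> {affine_family a1 a2 a3 a4 b1 b2 b3 b4 x y | x y. True}"
  assumes U: "regular_subgroup 2 U"
  shows "U = S21 \<or> (\<exists>k \<alpha> \<beta> p q. k \<noteq> 0 \<and> p * \<alpha> + q * \<beta> = 1 \<and>
     U = {affine_family (- k*\<alpha>*\<beta>*\<alpha>) (k*\<alpha>*\<alpha>*\<alpha>) (- k*\<beta>*\<beta>*\<alpha>) (k*\<alpha>*\<beta>*\<alpha>)
            (- k*\<alpha>*\<beta>*\<beta>) (k*\<alpha>*\<alpha>*\<beta>) (- k*\<beta>*\<beta>*\<beta>) (k*\<alpha>*\<beta>*\<beta>) x y | x y. True})"
proof -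
  \<comment> \<open>From here on these names denote the entries of \<delta>(x, y), not the scalars
    \<open>p\<close> and \<open>q\<close> of the conclusion.\<close>
  define p q r s where "p = (\<lambda>x y. x * a1 + y * b1)" and "q = (\<lambda>x y. x * a2 + y * b2)"
    and "r = (\<lambda>x y. x * a3 + y * b3)" and "s = (\<lambda>x y. x * a4 + y * b4)"
  have fam: "affine_family a1 a2 a3 a4 b1 b2 b3 b4 x y = mat3 1 x y 0 (1 + p x y) (q x y) 0 (r x y) (1 + s x y)" for x y
    by (simp add: affine_family_def p_def q_def r_def s_def)
  have mult_mem: "mat3 1 x y 0 (1 + p x y) (q x y) 0 (r x y) (1 + s x y)
    * mat3 1 x' y' 0 (1 + p x' y') (q x' y') 0 (r x' y') (1 + s x' y') \<in> U" for x y x' y'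
  proof (rule regular_subgroup_2D(2)[OF U])
    show "mat3 1 x y 0 (1 + p x y) (q x y) 0 (r x y) (1 + s x y) \<in> U" for x y
      by (auto simp: U_def fam)
    then show "mat3 1 x' y' 0 (1 + p x' y') (q x' y') 0 (r x' y') (1 + s x' y') \<in> U" .
  qed
  have inv: "(1 + p x y) * (1 + s x y) - q x y * r x y \<noteq> 0" for x y
  proof -
    have "affine_family a1 a2 a3 a4 b1 b2 b3 b4 x y \<in> carrier (AGL 2)"
      using regular_subgroup_2D(1)[OF U] by (auto simp: U_def)
    then show ?thesis by (simp add: fam mat3_in_carrier_AGL2_iff)
  qed
  have mult: "p x y * p x' y' + q x y * r x' y' = p (x * p x' y' + y * r x' y') (x * q x' y' + y * s x' y')"
    "p x y * q x' y' + q x y * s x' y' = q (x * p x' y' + y * r x' y') (x * q x' y' + y * s x' y')"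
    "r x y * p x' y' + s x y * r x' y' = r (x * p x' y' + y * r x' y') (x * q x' y' + y * s x' y')"
    "r x y * q x' y' + s x y * s x' y' = s (x * p x' y' + y * r x' y') (x * q x' y' + y * s x' y')"
    for x y x' y'
  proof -
    obtain u v where "mat3 1 x y 0 (1 + p x y) (q x y) 0 (r x y) (1 + s x y)
      * mat3 1 x' y' 0 (1 + p x' y') (q x' y') 0 (r x' y') (1 + s x' y')
      = mat3 1 u v 0 (1 + p u v) (q u v) 0 (r u v) (1 + s u v)"
      using mult_mem unfolding U_def fam by blast
    then have *: "u = x' + x * (1 + p x' y') + y * r x' y'" "v = y' + x * q x' y' + y * (1 + s x' y')"
      "(1 + p x y) * (1 + p x' y') + q x y * r x' y' = 1 + p u v"
      "(1 + p x y) * q x' y' + q x y * (1 + s x' y') = q u v"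
      "r x y * (1 + p x' y') + (1 + s x y) * r x' y' = r u v"
      "r x y * q x' y' + (1 + s x y) * (1 + s x' y') = 1 + s u v"
      unfolding mat3_mult mat3_eq_iff by simp_all
    \<comment> \<open>The product of the elements with first rows (1, v) and (1, w) has first row
      (1, v + w + v \<delta>(w)), and (u', v') is the summand v \<delta>(w). Additivity of \<delta>
      then cancels the linear terms of (I + \<delta>(v)) (I + \<delta>(w)).\<close>
    define u' v' where "u' = x * p x' y' + y * r x' y'" and "v' = x * q x' y' + y * s x' y'"
    have uv: "u = x + x' + u'" "v = y + y' + v'"
      unfolding *(1,2) u'_def v'_def by (simp_all add: algebra_simps)
    have add: "p u v = p x y + p x' y' + p u' v'" "q u v = q x y + q x' y' + q u' v'"
      "r u v = r x y + r x' y' + r u' v'" "s u v = s x y + s x' y' + s u' v'"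
      unfolding uv by (simp_all add: p_def q_def r_def s_def algebra_simps)
    show "p x y * p x' y' + q x y * r x' y' = p (x * p x' y' + y * r x' y') (x * q x' y' + y * s x' y')"
      "p x y * q x' y' + q x y * s x' y' = q (x * p x' y' + y * r x' y') (x * q x' y' + y * s x' y')"
      "r x y * p x' y' + s x y * r x' y' = r (x * p x' y' + y * r x' y') (x * q x' y' + y * s x' y')"
      "r x y * q x' y' + s x y * s x' y' = s (x * p x' y' + y * r x' y') (x * q x' y' + y * s x' y')"
      using *(3-6) unfolding add u'_def[symmetric] v'_def[symmetric] by (simp_all add: algebra_simps)
  qed
  have scale: "p (c * x) (c * y) = c * p x y" "q (c * x) (c * y) = c * q x y"
      "r (c * x) (c * y) = c * r x y" "s (c * x) (c * y) = c * s x y" for c x y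
    by (simp_all add: p_def q_def r_def s_def algebra_simps)
  note nil = mat2_family_nilpotent[OF mult scale inv]
  have a4: "a4 = - a1" and b4: "b4 = - b1"
    using nil(2)[of 1 0] nil(2)[of 0 1] by (simp_all add: p_def s_def add_eq_0_iff)
  have det: "a1 * a1 + a2 * a3 = 0" "b1 * b1 + b2 * b3 = 0"
    using nil(1)[of 1 0] nil(1)[of 0 1] by (simp_all add: p_def q_def r_def s_def a4 b4 add_eq_0_iff)
  \<comment> \<open>Closure is evaluated on basis vectors. With A^2 = B^2 = 0 from nilpotency it
    reads a1 A + a2 B = 0, A B = b1 A + b2 B, B A = a3 A - a1 B and b3 A - b1 B = 0.\<close>
  have AA: "a1 * a1 + a2 * b1 = 0" "a1 * a2 + a2 * b2 = 0"
    "a1 * a3 + a2 * b3 = 0"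
    using mult[of 1 0 1 0] by (simp_all add: p_def q_def r_def s_def a4 b4 det)
  have AB: "a1 * b1 + a2 * b3 = b1 * a1 + b2 * b1" "a1 * b2 - a2 * b1 = b1 * a2 + b2 * b2"
    "a3 * b1 - a1 * b3 = b1 * a3 + b2 * b3"
    using mult[of 1 0 0 1] by (simp_all add: p_def q_def r_def s_def a4 b4)
  have BA: "b1 * a1 + b2 * a3 = a3 * a1 - a1 * b1" "b1 * a2 - b2 * a1 = a3 * a2 - a1 * b2"
    "b3 * a1 - b1 * a3 = a3 * a3 - a1 * b3"
    using mult[of 0 1 1 0] by (simp_all add: p_def q_def r_def s_def a4 b4)
  have BB: "b3 * a1 - b1 * b1 = 0" "b3 * a2 - b1 * b2 = 0" "b3 * a3 - b1 * b3 = 0"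
    using mult[of 0 1 0 1] by (simp_all add: p_def q_def r_def s_def a4 b4 det)
  \<comment> \<open>In the normal form a2 = k \<alpha>^3 and b3 = -k \<beta>^3. So \<open>a2\<close>
    detects \<alpha>, which is then scaled to 1 with k = a2; otherwise \<open>b3\<close> detects
    \<beta>, scaled to 1 with k = -b3. If both vanish, \<delta> = 0.\<close>
  consider (a) "a2 \<noteq> 0" | (b) "a2 = 0" "b3 \<noteq> 0" | (0) "a2 = 0" "b3 = 0"
    by blast
  then show ?thesis
  proof cases
    case a
    define \<beta> where "\<beta> = - a1 / a2"
    have a1: "a1 = - \<beta> * a2" using a by (simp add: \<beta>_def)
    \<comment> \<open>Vanishing of det A yields \<open>a3\<close>; the relation a1 A + a2 B = 0 says
      B = \<beta> A and yields the entries of B.\<close>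
    have "a2 * (a3 + \<beta> * \<beta> * a2) = 0" "a2 * (b1 + \<beta> * \<beta> * a2) = 0" "a2 * (b2 - \<beta> * a2) = 0"
      using det(1) AA(1,2) unfolding a1 by (simp_all add: algebra_simps)
    then have a3: "a3 = - \<beta> * \<beta> * a2" and b1: "b1 = - \<beta> * \<beta> * a2" and b2: "b2 = \<beta> * a2"
      using a by (simp_all add: add_eq_0_iff)
    have "a2 * (b3 + \<beta> * \<beta> * \<beta> * a2) = 0"
      using AA(3) unfolding a1 a3 by (simp add: algebra_simps)
    then have b3: "b3 = - \<beta> * \<beta> * \<beta> * a2"
      using a by (simp add: add_eq_0_iff)
    show ?thesis
      unfolding U_def
      by (rule disjI2, rule exI[of _ a2], rule exI[of _ 1], rule exI[of _ \<beta>], rule exI[of _ 1], rule exI[of _ 0])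
        (use a in \<open>simp add: a1 a3 a4 b1 b2 b3 b4 mult_ac\<close>)
  next
    case b
    then have "a1 = 0" using det by simp
    then have "b1 = 0" using BB by simp
    then have "b2 = 0" "a3 = 0" using AB BB b \<open>a1 = 0\<close> by auto
    show ?thesis
      unfolding U_def
      by (rule disjI2, rule exI[of _ "- b3"], rule exI[of _ 0], rule exI[of _ 1], rule exI[of _ 0], rule exI[of _ 1])
        (use b \<open>a1 = 0\<close> \<open>b1 = 0\<close> \<open>b2 = 0\<close> \<open>a3 = 0\<close> in \<open>simp add: a4 b4\<close>)
  next
    case 0
    then have "a1 = 0" "b1 = 0" using det by simp_all
    then have "b2 = 0" "a3 = 0" using AB BA 0 by simp_all
    then show ?thesis
      unfolding U_def S21_eq affine_family_def using 0 \<open>a1 = 0\<close> \<open>b1 = 0\<close> a4 b4 by simp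
  qed
qed

text \<open>Put e = (p, q) and f = e N = (-k \<beta>, k \<alpha>). Then \<phi>(e) = 1, \<phi>(f) = 0
  and f N = 0, so in the basis e, f the form \<phi> is the first coordinate and N is the upper right
  matrix unit: this is \<open>S3\<close>.\<close>

lemma conjugate_in_S3_or_S21:
  assumes "regular_subgroup 2 (U :: 'a::field mat set)" "delta_linear 2 U"
  shows "conjugate_in (AGL 2) U S3 \<or> U = S21"
proof -
  interpret group "AGL 2 :: 'a mat monoid" by (rule group_AGL2)
  obtain a1 a2 a3 a4 b1 b2 b3 b4 where U: "U = {affine_family a1 a2 a3 a4 b1 b2 b3 b4 x y | x y. True}"
    using regular_delta_linear_2_eq_range[OF assms] .
  consider "U = S21" | (c) k \<alpha> \<beta> p q where "k \<noteq> 0" "p * \<alpha> + q * \<beta> = 1"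
     "U = {affine_family (- k*\<alpha>*\<beta>*\<alpha>) (k*\<alpha>*\<alpha>*\<alpha>) (- k*\<beta>*\<beta>*\<alpha>) (k*\<alpha>*\<beta>*\<alpha>)
            (- k*\<alpha>*\<beta>*\<beta>) (k*\<alpha>*\<alpha>*\<beta>) (- k*\<beta>*\<beta>*\<beta>) (k*\<alpha>*\<beta>*\<beta>) x y | x y. True}"
    using affine_family_normal_form[of a1 a2 a3 a4 b1 b2 b3 b4] assms(1) unfolding U by blast
  then show ?thesis
  proof cases
    case c
    \<comment> \<open>The rows of the linear part are e and f; its determinant is k.\<close>
    define g where "g = mat3 1 0 0 0 p q 0 (- k * \<beta>) (k * \<alpha>)"
    have "p * (k * \<alpha>) - q * (- k * \<beta>) = k * (p * \<alpha> + q * \<beta>)" by (simp add: algebra_simps)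
    then have g: "g \<in> carrier (AGL 2)"
      using c(1,2) by (simp add: g_def mat3_in_carrier_AGL2_iff)
    let ?f = "affine_family (- k*\<alpha>*\<beta>*\<alpha>) (k*\<alpha>*\<alpha>*\<alpha>) (- k*\<beta>*\<beta>*\<alpha>) (k*\<alpha>*\<beta>*\<alpha>)
            (- k*\<alpha>*\<beta>*\<beta>) (k*\<alpha>*\<alpha>*\<beta>) (- k*\<beta>*\<beta>*\<beta>) (k*\<alpha>*\<beta>*\<beta>)"
    have f: "?f x y = mat3 1 x y 0 (1 - k*\<alpha>*\<beta>*(\<alpha>*x + \<beta>*y)) (k*\<alpha>*\<alpha>*(\<alpha>*x + \<beta>*y))
        0 (- k*\<beta>*\<beta>*(\<alpha>*x + \<beta>*y)) (1 + k*\<alpha>*\<beta>*(\<alpha>*x + \<beta>*y))" for x y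
      unfolding affine_family_def mat3_eq_iff by (simp add: algebra_simps)
    \<comment> \<open>The element of \<open>U\<close> at the vector z e + w f corresponds to the
      element of \<open>S3\<close> with first row (1, z, w).\<close>
    have key: "g * ?f (p * z - k * \<beta> * w) (q * z + k * \<alpha> * w) = mat3 1 z w 0 1 z 0 0 1 * g" for z w
    proof -
      have "\<alpha> * (p * z - k * \<beta> * w) + \<beta> * (q * z + k * \<alpha> * w) = (p * \<alpha> + q * \<beta>) * z"
        by (simp add: algebra_simps)
      then have z: "\<alpha> * (p * z - k * \<beta> * w) + \<beta> * (q * z + k * \<alpha> * w) = z"
        using c(2) by simp
      have "p * (1 - k*\<alpha>*\<beta>*z) + q * (- k*\<beta>*\<beta>*z) = p - k*\<beta>*z*(p * \<alpha> + q * \<beta>)"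
        "p * (k*\<alpha>*\<alpha>*z) + q * (1 + k*\<alpha>*\<beta>*z) = q + k*\<alpha>*z*(p * \<alpha> + q * \<beta>)"
        by (simp_all add: algebra_simps)
      then have "p * (1 - k*\<alpha>*\<beta>*z) + q * (- k*\<beta>*\<beta>*z) = p - k*\<beta>*z"
        "p * (k*\<alpha>*\<alpha>*z) + q * (1 + k*\<alpha>*\<beta>*z) = q + k*\<alpha>*z"
        using c(2) by simp_all
      moreover have "- k*\<beta> * (1 - k*\<alpha>*\<beta>*z) + k*\<alpha> * (- k*\<beta>*\<beta>*z) = - k*\<beta>"
        "- k*\<beta> * (k*\<alpha>*\<alpha>*z) + k*\<alpha> * (1 + k*\<alpha>*\<beta>*z) = k*\<alpha>"
        by (simp_all add: algebra_simps)
      ultimately show ?thesis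
        unfolding f z g_def mat3_mult mat3_eq_iff by (simp add: mult_ac)
    qed
    \<comment> \<open>Every vector is z e + w f, with z = \<phi>(x, y) and w found by Cramer's
      rule.\<close>
    have coords: "\<exists>z w. x = p * z - k * \<beta> * w \<and> y = q * z + k * \<alpha> * w" for x y
    proof (intro exI conjI)
      have div: "k * t * ((p*y - q*x) / k) = t * (p*y - q*x)" for t
        using c(1) by simp
      have "p * (\<alpha>*x + \<beta>*y) - k * \<beta> * ((p*y - q*x) / k) = (p * \<alpha> + q * \<beta>) * x"
        "q * (\<alpha>*x + \<beta>*y) + k * \<alpha> * ((p*y - q*x) / k) = (p * \<alpha> + q * \<beta>) * y"
        unfolding div by (simp_all add: algebra_simps)
      then show "x = p * (\<alpha>*x + \<beta>*y) - k * \<beta> * ((p*y - q*x) / k)"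
        "y = q * (\<alpha>*x + \<beta>*y) + k * \<alpha> * ((p*y - q*x) / k)"
        using c(2) by simp_all
    qed
    have "\<exists>k\<in>S3. g * h = k * g" if "h \<in> U" for h
    proof -
      obtain x y where "h = ?f x y" using \<open>h \<in> U\<close> c(3) by blast
      moreover obtain z w where "x = p * z - k * \<beta> * w" "y = q * z + k * \<alpha> * w" using coords by blast
      ultimately have "g * h = mat3 1 z w 0 1 z 0 0 1 * g" using key by simp
      then show ?thesis by (auto simp: S3_eq)
    qed
    moreover have "\<exists>h\<in>U. g * h = k * g" if "k \<in> S3" for k
    proof -
      obtain z w where "k = mat3 1 z w 0 1 z 0 0 1" using \<open>k \<in> S3\<close> by (auto simp: S3_eq)
      then show ?thesis using key[of z w] c(3) by blast
    qed
    ultimately have "conjugate_in (AGL 2) U S3"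
      using conjugate_in_iff[OF regular_subgroup_2D(1)[OF assms(1)] regular_subgroup_2D(1)[OF regular_S3]] g
      by (auto simp: AGL_mult)
    then show ?thesis ..
  qed simp
qed

text \<open>The class of \<open>S21\<close> consists of \<open>S21\<close> alone, and every other
  group in question is conjugate to \<open>S3\<close>, which differs from
  \<open>S21\<close>.\<close>

lemma conjugacy_representatives_S3_S21:
  "conjugacy_representatives (AGL 2)
     {U :: 'a::field mat set. regular_subgroup 2 U \<and> delta_linear 2 U} {S3, S21}"
  unfolding conjugacy_representatives_def
proof (intro conjI ballI)
  show "{S3, S21} \<subseteq> {U :: 'a mat set. regular_subgroup 2 U \<and> delta_linear 2 U}"
    using regular_S3 regular_S21 delta_linear_S3 delta_linear_S21 by blast
next
  interpret group "AGL 2 :: 'a mat monoid" by (rule group_AGL2)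
  have S21_S3: "\<not> conjugate_in (AGL 2) S21 (S3 :: 'a mat set)"
    using conjugate_in_sym[OF regular_subgroup_2D(1)[OF regular_S21] regular_subgroup_2D(1)[OF regular_S3]]
      conjugate_in_S21_iff[OF regular_subgroup_2D(1)[OF regular_S3]] S3_neq_S21 by blast
  fix U :: "'a mat set"
  assume "U \<in> {U. regular_subgroup 2 U \<and> delta_linear 2 U}"
  then have U: "regular_subgroup 2 U" "delta_linear 2 U" by auto
  note S21_iff = conjugate_in_S21_iff[OF regular_subgroup_2D(1)[OF U(1)]]
  show "\<exists>!S. S \<in> {S3, S21} \<and> conjugate_in (AGL 2) U S"
  proof (cases "U = S21")
    case True
    then show ?thesis using S21_iff S21_S3 by auto
  next
    case False
    then show ?thesis using S21_iff conjugate_in_S3_or_S21[OF U] by auto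
  qed
qed

section \<open>Quotient algebras\<close>

text \<open>The laws of an algebra are identities together with additive inverses, and a surjection
  respecting the operations carries both over. \<open>A\<close> itself is not assumed to be a ring;
  this supplies the algebra structure on quotients and on the matrix sets.\<close>

lemma algebra_surj_image:
  assumes P: "algebra K P" and surj: "h ` carrier P = carrier A"
    and mult: "\<And>x y. x \<in> carrier P \<Longrightarrow> y \<in> carrier P \<Longrightarrow> h (x \<otimes>\<^bsub>P\<^esub> y) = h x \<otimes>\<^bsub>A\<^esub> h y"
    and add: "\<And>x y. x \<in> carrier P \<Longrightarrow> y \<in> carrier P \<Longrightarrow> h (x \<oplus>\<^bsub>P\<^esub> y) = h x \<oplus>\<^bsub>A\<^esub> h y"
    and smult: "\<And>c x. c \<in> carrier K \<Longrightarrow> x \<in> carrier P \<Longrightarrow> h (c \<odot>\<^bsub>P\<^esub> x) = c \<odot>\<^bsub>A\<^esub> h x"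
    and one: "h \<one>\<^bsub>P\<^esub> = \<one>\<^bsub>A\<^esub>" and zero: "h \<zero>\<^bsub>P\<^esub> = \<zero>\<^bsub>A\<^esub>"
  shows "algebra K A"
proof -
  interpret P: algebra K P by (rule P)
  \<comment> \<open>Read from right to left, these rules pull every operation of \<open>A\<close>
    back inside \<open>h\<close>, where the laws of \<open>P\<close> apply.\<close>
  note hom = mult[symmetric] add[symmetric] smult[symmetric] one[symmetric] zero[symmetric]
  have closed: "h x \<in> carrier A" if "x \<in> carrier P" for x
    using that surj by blast
  have pre: "\<exists>x\<in>carrier P. a = h x" if "a \<in> carrier A" for a
    using that surj by blast
  show ?thesis
  proof (rule algebraI)
    show "cring K" by (rule P.R_cring)
    show "cring A"
    proof (rule cringI)
      show "abelian_group A"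
      proof (rule abelian_groupI)
        fix a assume "a \<in> carrier A"
        then obtain x where x: "x \<in> carrier P" "a = h x" using pre by blast
        then have "h (\<ominus>\<^bsub>P\<^esub> x) \<oplus>\<^bsub>A\<^esub> a = \<zero>\<^bsub>A\<^esub>"
          by (simp add: hom P.l_neg)
        then show "\<exists>b\<in>carrier A. b \<oplus>\<^bsub>A\<^esub> a = \<zero>\<^bsub>A\<^esub>"
          using closed x(1) by blast
      qed (auto dest!: pre simp: hom closed P.M.add.m_ac)
      show "comm_monoid A"
        by (rule comm_monoidI) (auto dest!: pre simp: hom closed P.m_ac)
    qed (auto dest!: pre simp: hom P.l_distr)
  qed (auto dest!: pre simp: hom closed P.smult_l_distr P.smult_r_distr P.smult_assoc1 P.smult_assoc2)
qed

lemma quotient_algebra_simps [simp]: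
  "carrier (quotient_algebra A I) = carrier (A Quot I)"
  "mult (quotient_algebra A I) = mult (A Quot I)"
  "one (quotient_algebra A I) = one (A Quot I)"
  "zero (quotient_algebra A I) = zero (A Quot I)"
  "add (quotient_algebra A I) = add (A Quot I)"
  by (simp_all add: quotient_algebra_def ring.defs module.defs FactRing_def)

text \<open>The union over all representatives in \<open>quotient_algebra\<close> collapses to one
  coset, because an ideal is stable under scalars.\<close>

lemma quotient_algebra_smult:
  assumes "algebra K A" "ideal I A" "c \<in> carrier K" "x \<in> carrier A"
  shows "c \<odot>\<^bsub>quotient_algebra A I\<^esub> (I +>\<^bsub>A\<^esub> x) = I +>\<^bsub>A\<^esub> (c \<odot>\<^bsub>A\<^esub> x)"
proof -
  interpret A: algebra K A by fact
  interpret I: ideal I A by fact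
  have "I +>\<^bsub>A\<^esub> (c \<odot>\<^bsub>A\<^esub> x') = I +>\<^bsub>A\<^esub> (c \<odot>\<^bsub>A\<^esub> x)" if "x' \<in> I +>\<^bsub>A\<^esub> x" for x'
  proof -
    obtain i where i: "i \<in> I" "x' = i \<oplus>\<^bsub>A\<^esub> x"
      using \<open>x' \<in> I +>\<^bsub>A\<^esub> x\<close> by (auto simp: a_r_coset_def')
    have iA: "i \<in> carrier A" using i I.a_subset by blast
    \<comment> \<open>An ideal absorbs ring elements, so the scalar is first turned into the ring
      element c 1.\<close>
    have "c \<odot>\<^bsub>A\<^esub> i = (c \<odot>\<^bsub>A\<^esub> \<one>\<^bsub>A\<^esub>) \<otimes>\<^bsub>A\<^esub> i"
      using assms(3) iA by (simp add: A.smult_assoc2)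
    then have ci: "c \<odot>\<^bsub>A\<^esub> i \<in> I"
      using i assms(3) by (simp add: I.I_l_closed)
    have "I +>\<^bsub>A\<^esub> (c \<odot>\<^bsub>A\<^esub> x') = (I +>\<^bsub>A\<^esub> (c \<odot>\<^bsub>A\<^esub> i)) +>\<^bsub>A\<^esub> (c \<odot>\<^bsub>A\<^esub> x)"
      using i iA assms(3,4) I.a_subset by (simp add: A.smult_r_distr A.a_coset_add_assoc)
    then show ?thesis
      by (simp add: I.a_rcos_const[OF ci])
  qed
  then have "(\<Union>x'\<in>I +>\<^bsub>A\<^esub> x. I +>\<^bsub>A\<^esub> (c \<odot>\<^bsub>A\<^esub> x')) = (\<Union>x'\<in>I +>\<^bsub>A\<^esub> x. I +>\<^bsub>A\<^esub> (c \<odot>\<^bsub>A\<^esub> x))"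
    by (rule SUP_cong[OF refl])
  also have "\<dots> = I +>\<^bsub>A\<^esub> (c \<odot>\<^bsub>A\<^esub> x)"
    using I.a_rcos_self[OF assms(4)] by (intro SUP_const) blast
  finally show ?thesis
    by (simp only: quotient_algebra_def ring.defs module.defs module.simps)
qed

lemma algebra_quotient_algebra:
  assumes "algebra K A" "ideal I A"
  shows "algebra K (quotient_algebra A I)"
proof -
  interpret A: algebra K A by fact
  interpret I: ideal I A by fact
  show ?thesis
  proof (rule algebra_surj_image[OF assms(1), where h = "\<lambda>x. I +>\<^bsub>A\<^esub> x"])
    show "(\<lambda>x. I +>\<^bsub>A\<^esub> x) ` carrier A = carrier (quotient_algebra A I)"
      by (auto simp: FactRing_def A_RCOSETS_def')
    show "I +>\<^bsub>A\<^esub> \<zero>\<^bsub>A\<^esub> = \<zero>\<^bsub>quotient_algebra A I\<^esub>"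
      by (simp add: FactRing_def I.a_subset)
  qed (simp_all add: FactRing_def I.rcoset_mult_add I.a_rcos_sum quotient_algebra_smult[OF assms])
qed

text \<open>This is the first isomorphism theorem for algebras. The induced map runs from the
  quotient to \<open>A\<close>, so its inverse is the isomorphism required.\<close>

lemma algebra_isomorphic_quotient_algebra:
  assumes P: "algebra class_ring P" and surj: "h ` carrier P = carrier A"
    and mult: "\<And>x y. x \<in> carrier P \<Longrightarrow> y \<in> carrier P \<Longrightarrow> h (x \<otimes>\<^bsub>P\<^esub> y) = h x \<otimes>\<^bsub>A\<^esub> h y"
    and add: "\<And>x y. x \<in> carrier P \<Longrightarrow> y \<in> carrier P \<Longrightarrow> h (x \<oplus>\<^bsub>P\<^esub> y) = h x \<oplus>\<^bsub>A\<^esub> h y"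
    and smult: "\<And>c x. x \<in> carrier P \<Longrightarrow> h (c \<odot>\<^bsub>P\<^esub> x) = c \<odot>\<^bsub>A\<^esub> h x"
    and one: "h \<one>\<^bsub>P\<^esub> = \<one>\<^bsub>A\<^esub>" and zero: "h \<zero>\<^bsub>P\<^esub> = \<zero>\<^bsub>A\<^esub>"
    and ker: "{x \<in> carrier P. h x = \<zero>\<^bsub>A\<^esub>} = I"
  shows "algebra_isomorphic (A :: ('k::field, 'c) module) (quotient_algebra P I)"
proof -
  interpret P: algebra class_ring P by (rule P)
  have A: "algebra class_ring A"
    by (rule algebra_surj_image[OF P surj mult add smult one zero])
  interpret A: algebra class_ring A by (rule A)
  have closed: "h x \<in> carrier A" if "x \<in> carrier P" for x
    using surj that by blast
  interpret h: ring_hom_ring P A h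
    by (rule ring_hom_ringI[OF P.ring_axioms A.ring_axioms closed mult add one])
  have I: "a_kernel P A h = I"
    using ker unfolding a_kernel_def' .
  have ideal: "ideal I P" using h.kernel_is_ideal I by simp
  let ?Q = "quotient_algebra P I"
  let ?f = "\<lambda>X. the_elem (h ` X)"
  have Q: "algebra class_ring ?Q"
    by (rule algebra_quotient_algebra[OF P ideal])
  have f: "?f \<in> ring_iso ?Q A"
    using h.FactRing_iso_set[OF surj] I by (simp add: ring_iso_def Ring.ring_hom_def)
  have f_coset: "?f (I +>\<^bsub>P\<^esub> x) = h x" if "x \<in> carrier P" for x
    using h.the_elem_simp[OF that] I by simp
  have coset: "I +>\<^bsub>P\<^esub> x \<in> carrier ?Q" if "x \<in> carrier P" for x
    using that by (auto simp: FactRing_def A_RCOSETS_def')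
  have inj: "inj_on ?f (carrier ?Q)"
    using f by (simp add: ring_iso_def bij_betw_def)
  let ?g = "inv_into (carrier ?Q) ?f"
  have g: "?g \<in> ring_iso A ?Q"
    using Q f by (intro ring_iso_set_sym) (simp_all add: algebra.M_cring cring.axioms(1))
  have g_h: "?g (h x) = I +>\<^bsub>P\<^esub> x" if "x \<in> carrier P" for x
    using inv_into_f_f[OF inj coset[OF that]] f_coset[OF that] by simp
  have "?g (c \<odot>\<^bsub>A\<^esub> a) = c \<odot>\<^bsub>?Q\<^esub> ?g a" if "a \<in> carrier A" for c a
  proof -
    obtain x where x: "x \<in> carrier P" "a = h x" using \<open>a \<in> carrier A\<close> surj by blast
    then have "?g (c \<odot>\<^bsub>A\<^esub> a) = I +>\<^bsub>P\<^esub> (c \<odot>\<^bsub>P\<^esub> x)"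
      using g_h[of "c \<odot>\<^bsub>P\<^esub> x"] by (simp add: smult)
    also have "\<dots> = c \<odot>\<^bsub>?Q\<^esub> ?g a"
      using quotient_algebra_smult[OF P ideal _ x(1), of c] unfolding x(2) g_h[OF x(1)] by simp
    finally show ?thesis .
  qed
  then show ?thesis
    unfolding algebra_isomorphic_def using A Q g by blast
qed

section \<open>The matrix algebras of the two groups\<close>

lemma matrix_algebra_2_simps:
  "mult (matrix_algebra 2 U) = (*)" "add (matrix_algebra 2 U) = (+)"
  "one (matrix_algebra 2 U) = mat3 1 0 0 0 1 0 0 0 1"
  "zero (matrix_algebra 2 U) = mat3 0 0 0 0 0 0 0 0 0"
  "module.smult (matrix_algebra 2 U) = (\<cdot>\<^sub>m)"
  by (simp_all add: matrix_algebra_def module_mat_simps mat3_one[symmetric] mat3_zero[symmetric])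

lemma carrier_matrix_algebra_S3:
  "carrier (matrix_algebra 2 (S3 :: 'a::field mat set)) = {mat3 d x y 0 d x 0 0 d | d x y. True}"
proof (intro equalityI subsetI)
  fix A :: "'a mat" assume "A \<in> carrier (matrix_algebra 2 S3)"
  then obtain a b x y where "A = a \<cdot>\<^sub>m 1\<^sub>m 3 + b \<cdot>\<^sub>m mat3 1 x y 0 1 x 0 0 1"
    by (auto simp: matrix_algebra_def S3_eq)
  then show "A \<in> {mat3 d x y 0 d x 0 0 d | d x y. True}"
    by (auto simp: mat3_one mat3_smult mat3_add mat3_eq_iff)
next
  fix A :: "'a mat" assume "A \<in> {mat3 d x y 0 d x 0 0 d | d x y. True}"
  then obtain d x y where "A = mat3 d x y 0 d x 0 0 d" by blast
  \<comment> \<open>The group element already contributes 1 to the diagonal, which leaves d - 1 for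
    the identity.\<close>
  then have "A = (d - 1) \<cdot>\<^sub>m 1\<^sub>m 3 + 1 \<cdot>\<^sub>m mat3 1 x y 0 1 x 0 0 1"
    by (simp add: mat3_one mat3_smult mat3_add mat3_eq_iff)
  moreover have "mat3 1 x y 0 1 x 0 0 1 \<in> S3" by (auto simp: S3_eq)
  ultimately show "A \<in> carrier (matrix_algebra 2 S3)"
    by (auto simp: matrix_algebra_def)
qed

lemma carrier_matrix_algebra_S21:
  "carrier (matrix_algebra 2 (S21 :: 'a::field mat set)) = {mat3 d x y 0 d 0 0 0 d | d x y. True}"
proof (intro equalityI subsetI)
  fix A :: "'a mat" assume "A \<in> carrier (matrix_algebra 2 S21)"
  then obtain a b x y where "A = a \<cdot>\<^sub>m 1\<^sub>m 3 + b \<cdot>\<^sub>m mat3 1 x y 0 1 0 0 0 1"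
    by (auto simp: matrix_algebra_def S21_eq)
  then show "A \<in> {mat3 d x y 0 d 0 0 0 d | d x y. True}"
    by (auto simp: mat3_one mat3_smult mat3_add mat3_eq_iff)
next
  fix A :: "'a mat" assume "A \<in> {mat3 d x y 0 d 0 0 0 d | d x y. True}"
  then obtain d x y where "A = mat3 d x y 0 d 0 0 0 d" by blast
  then have "A = (d - 1) \<cdot>\<^sub>m 1\<^sub>m 3 + 1 \<cdot>\<^sub>m mat3 1 x y 0 1 0 0 0 1"
    by (simp add: mat3_one mat3_smult mat3_add mat3_eq_iff)
  moreover have "mat3 1 x y 0 1 0 0 0 1 \<in> S21" by (auto simp: S21_eq)
  ultimately show "A \<in> carrier (matrix_algebra 2 S21)"
    by (auto simp: matrix_algebra_def)
qed

section \<open>Truncated polynomials in one indeterminate\<close>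

lemma poly_algebra_simps [simp]:
  "carrier poly_algebra = UNIV" "mult poly_algebra = (*)" "one poly_algebra = 1"
  "zero poly_algebra = 0" "add poly_algebra = (+)" "module.smult poly_algebra = Polynomial.smult"
  by (simp_all add: poly_algebra_def)

lemma algebra_poly_algebra: "algebra class_ring (poly_algebra :: ('a::field, 'a poly) module)"
proof (rule algebraI)
  show "cring (class_ring :: 'a ring)" by (rule class_cring.cring_axioms)
  show "cring (poly_algebra :: ('a, 'a poly) module)"
    by (intro cringI abelian_groupI comm_monoidI)
      (auto simp: algebra_simps intro: exI[of _ "- x" for x :: "'a poly"] ab_left_minus)
qed (simp_all add: smult_add_left smult_add_right)

lemma Idl_poly_algebra_X_power:
  "Idl\<^bsub>poly_algebra\<^esub> {[:0, 1:] ^ n} = {p :: 'a::field poly. \<forall>k<n. coeff p k = 0}"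
proof -
  interpret algebra class_ring "poly_algebra :: ('a, 'a poly) module" by (rule algebra_poly_algebra)
  have "Idl\<^bsub>poly_algebra\<^esub> {[:0, 1:] ^ n} = PIdl\<^bsub>poly_algebra\<^esub> ([:0, 1:] ^ n :: 'a poly)"
    by (simp add: cgenideal_eq_genideal)
  also have "\<dots> = {p. monom 1 n dvd p}"
    by (auto simp: cgenideal_def monom_altdef dvd_def mult.commute)
  finally show ?thesis by (simp add: monom_1_dvd_iff')
qed

text \<open>The map \<open>h\<close> evaluates a polynomial at the matrix N with ones on the
  superdiagonal and zeros elsewhere. Since N^3 = 0, only the coefficients of degree at most 2
  survive.\<close>

lemma matrix_algebra_S3_isomorphic:
  "algebra_isomorphic (matrix_algebra 2 (S3 :: 'a::field mat set)) truncated_poly_algebra"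
  unfolding truncated_poly_algebra_def
proof (rule algebra_isomorphic_quotient_algebra[OF algebra_poly_algebra, where
    h = "\<lambda>p. mat3 (coeff p 0) (coeff p 1) (coeff p 2) 0 (coeff p 0) (coeff p 1) 0 0 (coeff p 0)"],
    unfold matrix_algebra_2_simps poly_algebra_simps carrier_matrix_algebra_S3 Idl_poly_algebra_X_power)
  let ?h = "\<lambda>p. mat3 (coeff p 0) (coeff p 1) (coeff p 2) 0 (coeff p 0) (coeff p 1) 0 0 (coeff p 0 :: 'a)"
  have "mat3 d x y 0 d x 0 0 d = ?h [:d, x, y:]" for d x y :: 'a
    by (simp add: numeral_2_eq_2)
  then show "range ?h = {mat3 d x y 0 d x 0 0 d | d x y. True}"
    by blast
  show "{p \<in> UNIV. ?h p = mat3 0 0 0 0 0 0 0 0 0} = {p. \<forall>k<3. coeff p k = 0}"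
    by (auto simp: mat3_eq_iff less_3_iff)
qed (auto simp: mat3_mult mat3_add mat3_smult mat3_eq_iff coeff_mult numeral_2_eq_2 atMost_Suc algebra_simps)

section \<open>Truncated polynomials in two indeterminates\<close>

abbreviation unit_monom :: "'v \<Rightarrow> ('v \<Rightarrow>\<^sub>0 nat)" where
  "unit_monom i \<equiv> Poly_Mapping.single i 1"

lemma two_type_cases: "i = 1 \<or> i = (2::2)"
proof -
  have "{1, 2::2} = UNIV"
    by (rule card_subset_eq) simp_all
  then show ?thesis by blast
qed

lemma all_two_type: "(\<forall>i::2. P i) \<longleftrightarrow> P 1 \<and> P 2"
  by (metis two_type_cases)

lemma monom_neq_zeroE:
  assumes "m \<noteq> (0 :: 'v \<Rightarrow>\<^sub>0 nat)"
  obtains i m' where "m = unit_monom i + m'"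
proof -
  obtain i where i: "Poly_Mapping.lookup m i \<noteq> 0"
    using assms by (metis poly_mapping_eqI lookup_zero)
  have "m = unit_monom i + (m - unit_monom i)"
    using i by (intro poly_mapping_eqI) (auto simp: lookup_add lookup_minus lookup_single when_def)
  then show thesis by (rule that)
qed

lemma monom_add_eq_zero_iff: "k + l = (0 :: 'v \<Rightarrow>\<^sub>0 nat) \<longleftrightarrow> k = 0 \<and> l = 0"
  by (auto simp: poly_mapping_eq_iff fun_eq_iff lookup_add)

lemma monom_add_eq_unit_monom_iff:
  "k + l = unit_monom i \<longleftrightarrow> k = 0 \<and> l = unit_monom i \<or> k = unit_monom i \<and> l = (0 :: 'v \<Rightarrow>\<^sub>0 nat)"
proof
  assume *: "k + l = unit_monom i"
  show "k = 0 \<and> l = unit_monom i \<or> k = unit_monom i \<and> l = 0"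
  proof (cases "k = 0")
    case False
    then obtain j k' where k: "k = unit_monom j + k'" by (rule monom_neq_zeroE)
    have "Poly_Mapping.lookup (k + l) j \<noteq> 0" unfolding k by (simp add: lookup_add)
    then have "j = i" unfolding * by (simp add: lookup_single when_def split: if_splits)
    then have "k' + l = 0" using * k by (simp add: add.assoc)
    then show ?thesis using k \<open>j = i\<close> by (simp add: monom_add_eq_zero_iff)
  qed (use * in simp)
qed auto

lemma poly_mapping_eq_sum_single:
  "f = (\<Sum>k\<in>Poly_Mapping.keys f. Poly_Mapping.single k (Poly_Mapping.lookup f k))"
  by (rule poly_mapping_eqI) (auto simp: lookup_sum lookup_single when_def sum.delta' in_keys_iff)

text \<open>Multiplication as a finite double sum over the supports; a single coefficient then only
  requires the factorisations k + l = m of one monomial.\<close>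

lemma lookup_mult_keys:
  fixes f g :: "'m::monoid_add \<Rightarrow>\<^sub>0 'a::semiring_0"
  shows "Poly_Mapping.lookup (f * g) m = (\<Sum>k\<in>Poly_Mapping.keys f. \<Sum>l\<in>Poly_Mapping.keys g. if k + l = m then Poly_Mapping.lookup f k * Poly_Mapping.lookup g l else 0)"
proof -
  have "f * g = (\<Sum>k\<in>Poly_Mapping.keys f. \<Sum>l\<in>Poly_Mapping.keys g. Poly_Mapping.single (k + l) (Poly_Mapping.lookup f k * Poly_Mapping.lookup g l))"
    by (subst poly_mapping_eq_sum_single[of f], subst poly_mapping_eq_sum_single[of g])
      (simp add: sum_product mult_single)
  then show ?thesis
    by (simp add: lookup_sum lookup_single when_def)
qed

lemma lookup_mult_zero:
  fixes f g :: "('v \<Rightarrow>\<^sub>0 nat) \<Rightarrow>\<^sub>0 'a::semiring_0"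
  shows "Poly_Mapping.lookup (f * g) 0 = Poly_Mapping.lookup f 0 * Poly_Mapping.lookup g 0"
proof -
  have "Poly_Mapping.lookup (f * g) 0 = (\<Sum>k\<in>Poly_Mapping.keys f. if k = 0 then \<Sum>l\<in>Poly_Mapping.keys g. if l = 0 then Poly_Mapping.lookup f 0 * Poly_Mapping.lookup g 0 else 0 else 0)"
    unfolding lookup_mult_keys monom_add_eq_zero_iff by (intro sum.cong refl) auto
  then show ?thesis by (auto simp: in_keys_iff)
qed

text \<open>A Leibniz rule at the origin: an indeterminate factors only as itself times 1, in either
  order.\<close>

lemma lookup_mult_unit_monom:
  fixes f g :: "('v \<Rightarrow>\<^sub>0 nat) \<Rightarrow>\<^sub>0 'a::semiring_0"
  shows "Poly_Mapping.lookup (f * g) (unit_monom i) =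
    Poly_Mapping.lookup f 0 * Poly_Mapping.lookup g (unit_monom i) + Poly_Mapping.lookup f (unit_monom i) * Poly_Mapping.lookup g 0"
proof -
  have ne: "unit_monom i \<noteq> 0" by (metis lookup_single_eq lookup_zero zero_neq_one)
  have "Poly_Mapping.lookup (f * g) (unit_monom i) =
      (\<Sum>k\<in>Poly_Mapping.keys f. (if k = 0 then \<Sum>l\<in>Poly_Mapping.keys g. if l = unit_monom i then Poly_Mapping.lookup f 0 * Poly_Mapping.lookup g (unit_monom i) else 0 else 0)
        + (if k = unit_monom i then \<Sum>l\<in>Poly_Mapping.keys g. if l = 0 then Poly_Mapping.lookup f (unit_monom i) * Poly_Mapping.lookup g 0 else 0 else 0))"
    unfolding lookup_mult_keys monom_add_eq_unit_monom_iff using ne by (intro sum.cong refl) auto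
  then show ?thesis by (auto simp: sum.distrib in_keys_iff)
qed

text \<open>Scalar multiplication is expressed through constant polynomials, so that the algebra
  laws reduce to ring laws.\<close>

lemma mpoly_algebra_simps [simp]:
  "carrier mpoly_algebra = UNIV" "mult mpoly_algebra = (*)" "one mpoly_algebra = 1"
  "zero mpoly_algebra = 0" "add mpoly_algebra = (+)"
  "module.smult mpoly_algebra = (\<lambda>c p. Poly_Mapping.single 0 c * p)"
  by (simp_all add: mpoly_algebra_def mult_map_scale_conv_mult fun_eq_iff)

lemma algebra_mpoly_algebra:
  "algebra class_ring (mpoly_algebra :: ('a::field, ('v \<Rightarrow>\<^sub>0 nat) \<Rightarrow>\<^sub>0 'a) module)"
proof (rule algebraI)
  show "cring (class_ring :: 'a ring)" by (rule class_cring.cring_axioms)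
  show "cring (mpoly_algebra :: ('a, ('v \<Rightarrow>\<^sub>0 nat) \<Rightarrow>\<^sub>0 'a) module)"
    by (intro cringI abelian_groupI comm_monoidI)
      (auto simp: algebra_simps intro: exI[of _ "- x" for x :: "('v \<Rightarrow>\<^sub>0 nat) \<Rightarrow>\<^sub>0 'a"] ab_left_minus)
qed (simp_all add: single_add mult_single[of 0 _ 0, simplified, symmetric] algebra_simps)

abbreviation maximal_ideal_at_0 :: "((2 \<Rightarrow>\<^sub>0 nat) \<Rightarrow>\<^sub>0 'a::field) set" where
  "maximal_ideal_at_0 \<equiv> Idl\<^bsub>mpoly_algebra\<^esub> {indet 1, indet 2}"

lemma ideal_mpoly_algebraI:
  fixes I :: "(('v \<Rightarrow>\<^sub>0 nat) \<Rightarrow>\<^sub>0 'a::field) set"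
  assumes "0 \<in> I" "\<And>p q. p \<in> I \<Longrightarrow> q \<in> I \<Longrightarrow> p + q \<in> I" "\<And>p q. q \<in> I \<Longrightarrow> p * q \<in> I"
  shows "ideal I mpoly_algebra"
proof -
  interpret algebra class_ring "mpoly_algebra :: ('a, ('v \<Rightarrow>\<^sub>0 nat) \<Rightarrow>\<^sub>0 'a) module"
    by (rule algebra_mpoly_algebra)
  have a_inv: "\<ominus>\<^bsub>mpoly_algebra\<^esub> p = - p" for p :: "('v \<Rightarrow>\<^sub>0 nat) \<Rightarrow>\<^sub>0 'a"
    by (rule M.minus_equality) simp_all
  have "- p \<in> I" if "p \<in> I" for p
    using assms(3)[OF that, of "- 1"] by simp
  then show ?thesis
    using assms a_inv
    by (intro idealI ring_axioms M.add.subgroupI) (auto simp: a_inv_def mult.commute)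
qed

text \<open>The polynomials without constant term form an ideal containing both generators.\<close>

lemma maximal_ideal_at_0_lookup_zero:
  "p \<in> maximal_ideal_at_0 \<Longrightarrow> Poly_Mapping.lookup p 0 = (0::'a::field)"
proof -
  interpret algebra class_ring "mpoly_algebra :: ('a, (2 \<Rightarrow>\<^sub>0 nat) \<Rightarrow>\<^sub>0 'a) module"
    by (rule algebra_mpoly_algebra)
  have "unit_monom i \<noteq> (0 :: 2 \<Rightarrow>\<^sub>0 nat)" for i
    by (metis lookup_single_eq lookup_zero zero_neq_one)
  then have "maximal_ideal_at_0 \<subseteq> {p. Poly_Mapping.lookup p 0 = (0::'a)}"
    by (intro genideal_minimal ideal_mpoly_algebraI)
      (auto simp: lookup_add lookup_mult_zero indet_def lookup_single_not_eq)
  then show "p \<in> maximal_ideal_at_0 \<Longrightarrow> Poly_Mapping.lookup p 0 = 0" by blast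
qed

text \<open>By the Leibniz rule, a product of two polynomials without constant term has no linear
  term. Conversely, every monomial of degree at least 2 is divisible by a product of two
  indeterminates.\<close>

lemma square_maximal_ideal_at_0:
  "ideal_prod mpoly_algebra maximal_ideal_at_0 maximal_ideal_at_0 =
     {p. Poly_Mapping.lookup p 0 = (0::'a::field) \<and> (\<forall>i. Poly_Mapping.lookup p (unit_monom i) = 0)}"
    (is "?JJ = ?K")
proof
  interpret algebra class_ring "mpoly_algebra :: ('a, (2 \<Rightarrow>\<^sub>0 nat) \<Rightarrow>\<^sub>0 'a) module"
    by (rule algebra_mpoly_algebra)
  show "?JJ \<subseteq> ?K"
  proof
    fix p :: "(2 \<Rightarrow>\<^sub>0 nat) \<Rightarrow>\<^sub>0 'a" assume "p \<in> ?JJ"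
    then show "p \<in> ?K"
      by induction
        (auto simp: lookup_add lookup_mult_zero lookup_mult_unit_monom
          simp del: One_nat_def dest!: maximal_ideal_at_0_lookup_zero)
  qed
  have J: "ideal (maximal_ideal_at_0 :: ((2 \<Rightarrow>\<^sub>0 nat) \<Rightarrow>\<^sub>0 'a) set) mpoly_algebra"
    by (rule genideal_ideal) simp
  interpret JJ: ideal "?JJ" "mpoly_algebra :: ('a, (2 \<Rightarrow>\<^sub>0 nat) \<Rightarrow>\<^sub>0 'a) module"
    by (rule ideal_prod_is_ideal[OF J J])
  have indet: "indet i \<in> (maximal_ideal_at_0 :: ((2 \<Rightarrow>\<^sub>0 nat) \<Rightarrow>\<^sub>0 'a) set)" for i
    using genideal_self[of "{indet 1, indet 2}"] two_type_cases[of i] by auto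
  have monom: "Poly_Mapping.single m c \<in> ?JJ" if m: "m \<noteq> 0" "\<And>i. m \<noteq> unit_monom i" for m and c :: 'a
  proof -
    obtain i m1 where m1: "m = unit_monom i + m1" using m(1) by (rule monom_neq_zeroE)
    then have "m1 \<noteq> 0" using m(2)[of i] by auto
    then obtain j m2 where m2: "m1 = unit_monom j + m2" by (rule monom_neq_zeroE)
    have "indet j * Poly_Mapping.single m2 c \<in> maximal_ideal_at_0"
      using ideal.I_r_closed[OF J indet, of "Poly_Mapping.single m2 c" j] by simp
    then have "indet i * (indet j * Poly_Mapping.single m2 c) \<in> ?JJ"
      using ideal_prod.prod[OF indet[of i], of _ _ mpoly_algebra] by simp
    then show ?thesis by (simp add: indet_def mult_single m1 m2)
  qed
  show "?K \<subseteq> ?JJ"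
  proof
    fix p :: "(2 \<Rightarrow>\<^sub>0 nat) \<Rightarrow>\<^sub>0 'a" assume p: "p \<in> ?K"
    \<comment> \<open>The claim is generalised to subsets of the support so that induction can add
      one monomial at a time.\<close>
    have "(\<Sum>m\<in>M. Poly_Mapping.single m (Poly_Mapping.lookup p m)) \<in> ?JJ" if "finite M" "M \<subseteq> Poly_Mapping.keys p" for M
      using that
    proof (induction M)
      case empty
      then show ?case using JJ.zero_closed by simp
    next
      case (insert m M)
      have "Poly_Mapping.single m (Poly_Mapping.lookup p m) \<in> ?JJ"
        using p insert.prems by (intro monom) (auto simp: in_keys_iff)
      then show ?case using insert JJ.a_closed by simp
    qed
    from this[OF finite_keys order_refl] show "p \<in> ?JJ"
      by (simp only: poly_mapping_eq_sum_single[symmetric])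
  qed
qed

text \<open>The map \<open>h\<close> reads off the constant and the two linear coefficients. It is
  multiplicative by the Leibniz rule, and its kernel is the square just computed.\<close>

lemma matrix_algebra_S21_isomorphic:
  "algebra_isomorphic (matrix_algebra 2 (S21 :: 'a::field mat set)) truncated_mpoly2_algebra"
  unfolding truncated_mpoly2_algebra_def Let_def
proof (rule algebra_isomorphic_quotient_algebra[OF algebra_mpoly_algebra, where
    h = "\<lambda>p. mat3 (Poly_Mapping.lookup p 0) (Poly_Mapping.lookup p (unit_monom 1)) (Poly_Mapping.lookup p (unit_monom 2))
      0 (Poly_Mapping.lookup p 0) 0 0 0 (Poly_Mapping.lookup p 0)"],
    unfold matrix_algebra_2_simps mpoly_algebra_simps carrier_matrix_algebra_S21 square_maximal_ideal_at_0)
  let ?h = "\<lambda>p :: (2 \<Rightarrow>\<^sub>0 nat) \<Rightarrow>\<^sub>0 'a. mat3 (Poly_Mapping.lookup p 0) (Poly_Mapping.lookup p (unit_monom 1)) (Poly_Mapping.lookup p (unit_monom 2))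
      0 (Poly_Mapping.lookup p 0) 0 0 0 (Poly_Mapping.lookup p 0)"
  have ne: "unit_monom i \<noteq> (0 :: 2 \<Rightarrow>\<^sub>0 nat)" for i
    by (metis lookup_single_eq lookup_zero zero_neq_one)
  have ne12: "unit_monom 1 \<noteq> (unit_monom 2 :: 2 \<Rightarrow>\<^sub>0 nat)"
  proof
    assume "unit_monom 1 = (unit_monom 2 :: 2 \<Rightarrow>\<^sub>0 nat)"
    then have "Poly_Mapping.lookup (unit_monom 1) (1::2) = Poly_Mapping.lookup (unit_monom (2::2)) 1"
      by (rule arg_cong)
    then show False by (simp add: lookup_single when_def)
  qed
  have "mat3 d x y 0 d 0 0 0 d = ?h (Poly_Mapping.single 0 d + Poly_Mapping.single (unit_monom 1) x
      + Poly_Mapping.single (unit_monom 2) y)" for d x y :: 'a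
    using ne ne12 by (simp add: lookup_add lookup_single when_def)
  then show "range ?h = {mat3 d x y 0 d 0 0 0 d | d x y. True}"
    by blast
  show "{p \<in> UNIV. ?h p = mat3 0 0 0 0 0 0 0 0 0} = {p. Poly_Mapping.lookup p 0 = 0 \<and> (\<forall>i. Poly_Mapping.lookup p (unit_monom i) = 0)}"
    by (auto simp: mat3_eq_iff all_two_type)
  show "?h 1 = mat3 1 0 0 0 1 0 0 0 1"
    using ne by (simp add: lookup_one mat3_eq_iff)
  show "?h (p * q) = ?h p * ?h q" for p q
    by (simp add: mat3_mult mat3_eq_iff lookup_mult_zero lookup_mult_unit_monom del: One_nat_def)
  show "?h (Poly_Mapping.single 0 c * p) = c \<cdot>\<^sub>m ?h p" for c p
    using ne by (simp add: mat3_smult mat3_eq_iff lookup_mult_zero lookup_mult_unit_monom lookup_single when_def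
        del: One_nat_def)
qed (simp_all add: mat3_add mat3_eq_iff lookup_add)

theorem mainTheorem2:
  shows "(S3 :: 'a::field mat set) \<noteq> S21
    \<and> conjugacy_representatives (AGL 2)
        {U :: 'a mat set. regular_subgroup 2 U \<and> delta_linear 2 U} {S3, S21}
    \<and> algebra_isomorphic (matrix_algebra 2 (S3 :: 'a mat set)) truncated_poly_algebra
    \<and> algebra_isomorphic (matrix_algebra 2 (S21 :: 'a mat set)) truncated_mpoly2_algebra
    \<and> indecomposable 2 (S3 :: 'a mat set)"
  using S3_neq_S21 conjugacy_representatives_S3_S21 matrix_algebra_S3_isomorphic
    matrix_algebra_S21_isomorphic indecomposable_S3 by blast

end
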